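(* Let $A_1,A_2,B_1,B_2\in\mathbb{M}_m^+$ be such that $A_1A_2=A_2A_1$ and $B_1B_2=B_2B_1$. Then for every $\theta\in[0,1]$, \[ \lambda\Bigl(\bigl(A_1^\theta A_2^{1-\theta}\bigr)^{1/2}\bigl(B_1^\theta B_2^{1-\theta}\bigr)\bigl(A_1^\theta A_2^{1-\theta}\bigr)^{1/2}\Bigr)\prec_{\log}\Bigl(\lambda_i\bigl(A_1^{1/2}B_1A_1^{1/2}\bigr)^\theta\,\lambda_i\bigl(A_2^{1/2}B_2A_2^{1/2}\bigr)^{1-\theta}\Bigr)_{i=1}^m . \] Equivalently, $s\bigl((A_1^\theta A_2^{1-\theta})(B_1^\theta B_2^{1-\theta})\bigr)\prec_{\log}\bigl(s_i(A_1B_1)^\theta s_i(A_2B_2)^{1-\theta}\bigr)_{i=1}^m$. For $\theta\in\{0,1\}$ the statement holds under either of the two conventions: (1) $A_j^0:=I$ and $0^0:=1$ for scalars; or (2) $A_j^0:=$ the support projection of $A_j$ (similarly for $B_j$) and $0^0:=0$ for scalars.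
   Context: $\mathbb{M}_m$ denotes the complex $m\times m$ matrices and $\mathbb{M}_m^+$ the positive semidefinite ones. For $A\in\mathbb{M}_m^+$, $\lambda(A)=(\lambda_1(A),\dots,\lambda_m(A))$ are the eigenvalues in decreasing order with multiplicities; for $X\in\mathbb{M}_m$, $s(X)=(s_1(X),\dots,s_m(X))$ are the singular values in decreasing order. For $a,b\in[0,\infty)^m$, $a\prec_{\log}b$ means $\prod_{i=1}^k a_i^\downarrow\le\prod_{i=1}^k b_i^\downarrow$ for $k=1,\dots,m-1$ and $\prod_{i=1}^m a_i=\prod_{i=1}^m b_i$, where $a^\downarrow$ is the decreasing rearrangement of $a$. Real powers of positive semidefinite matrices are defined by functional calculus. *)

theory Defs
  imports "Jordan_Normal_Form.Char_Poly" "HOL-Computational_Algebra.Polynomial"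
begin

definition adj :: "complex mat \<Rightarrow> complex mat" where
  "adj A = mat (dim_col A) (dim_row A) (\<lambda>(i,j). cnj (A $$ (j,i)))"

definition unitary :: "nat \<Rightarrow> complex mat \<Rightarrow> bool" where
  "unitary m U \<longleftrightarrow> U \<in> carrier_mat m m \<and> U * adj U = 1\<^sub>m m"

definition psd :: "nat \<Rightarrow> complex mat \<Rightarrow> bool" where
  "psd m A \<longleftrightarrow> A \<in> carrier_mat m m \<and> adj A = A \<and>
     (\<forall>v \<in> carrier_vec m. 0 \<le> Re (conjugate v \<bullet> (A *\<^sub>v v)))"

definition rdiag :: "real list \<Rightarrow> complex mat" where
  "rdiag ls = mat (length ls) (length ls) (\<lambda>(i,j). if i = j then complex_of_real (ls ! i) else 0)"

(* eigenvalues with algebraic multiplicities, in decreasing order (meant for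
   Hermitian matrices, whose characteristic polynomial splits over the reals) *)
definition eigs :: "complex mat \<Rightarrow> real list" where
  "eigs A = (SOME ls. sorted_wrt (\<ge>) ls \<and>
      char_poly A = prod_list (map (\<lambda>l. [:- complex_of_real l, 1:]) ls))"

definition svals :: "complex mat \<Rightarrow> real list" where
  "svals X = map sqrt (eigs (adj X * X))"

definition mfun :: "(real \<Rightarrow> real) \<Rightarrow> complex mat \<Rightarrow> complex mat" where
  "mfun f A = (SOME B. \<exists>U ls. unitary (dim_row A) U \<and> length ls = dim_row A \<and>
      A = U * rdiag ls * adj U \<and> B = U * rdiag (map f ls) * adj U)"

(* the two conventions for real powers:
   (1) x^0 = 1 for all x (so A^0 = I, 0^0 = 1);
   (2) Isabelle's powr: 0 powr p = 0 (so A^0 = support projection, 0^0 = 0) *)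
definition pow_conv1 :: "real \<Rightarrow> real \<Rightarrow> real" where
  "pow_conv1 x p = (if p = 0 then 1 else x powr p)"

definition pow_conv2 :: "real \<Rightarrow> real \<Rightarrow> real" where
  "pow_conv2 x p = x powr p"

definition mpow :: "(real \<Rightarrow> real \<Rightarrow> real) \<Rightarrow> complex mat \<Rightarrow> real \<Rightarrow> complex mat" where
  "mpow pw A p = mfun (\<lambda>x. pw x p) A"

definition log_majorized :: "real list \<Rightarrow> real list \<Rightarrow> bool" where
  "log_majorized a b \<longleftrightarrow> length a = length b \<and>
     (\<forall>k \<in> {1..<length a}. prod_list (take k (rev (sort a))) \<le> prod_list (take k (rev (sort b)))) \<and>
     prod_list a = prod_list b"

end

(*
Diagonalising A1, A2 and B1, B2 simultaneously, every matrix in the statement becomes, up to unitary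
factors, K(t) = D(t) W E(t) with W unitary and D, E diagonal. Write s_k(M) for the product of the
k largest eigenvalues of M* M. Since D(t)^2 and E(t)^2 factor at a midpoint t = (r + s) / 2 as D(r) D(s)
and E(r) E(s), the matrices K(t)* K(t) and K(r)* K(s) have the same eigenvalues, and the
inequalities of Weyl and Horn give s_k(K(t))^2 <= s_k(K(r)) s_k(K(s)). So log s_k(K(t)) is midpoint
convex on [0,1], and lower semicontinuity turns this into convexity. With the first convention for
powers the endpoints are K(0) = D2 W E2 and K(1) = D1 W E1, but K jumps there when a matrix is
singular; the second convention is the limit t -> 0, 1 of the interior. The equality for k = m
is a determinant.

Exterior powers are avoided: s_k(M) is the maximum of det((M X)* M X) over the isometries X with k
columns, and the inequalities of Weyl and Horn are read off from this.
*)
theory Submission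
  imports Defs "Jordan_Normal_Form.Schur_Decomposition" "HOL-Analysis.Elementary_Metric_Spaces"
begin

subsection \<open>Unitary triangularization and simultaneous diagonalization\<close>

text \<open>The obstacle is zero: singular factors rule out logarithms and inverses. Convexity is
  therefore kept multiplicative, as f(mid)^2 <= f(s) f(t), and is compared with the candidate bound
  c1^t c2^(1-t), for which the same relation is an equality. The exponents at which the bound holds
  then form a set closed under midpoints, and the limit argument is needed just at interior points.
  The endpoints enter this set for free under the first convention, where both sides reduce to the
  given data. Under the second they are not free: a support projection may change the matrix while a
  vanishing c1 or c2 sends the bound to 0. This is why the first convention is settled before the
  second.

  Weyl's inequality is applied to a product that need not be Hermitian. Its eigenvalues are
  nevertheless known and real, because cyclic permutation of the factors gives it the characteristic
  polynomial of a Hermitian matrix.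

  The two majorizations of the theorem are one fact about singular values of
  diagonal-unitary-diagonal products: the second uses the eigenvalues of the A's and B's as
  diagonals, the first their square roots.\<close>

lemma mult_cnj_cmod: "z * cnj z = complex_of_real ((cmod z)\<^sup>2)"
  by (simp only: complex_norm_square)

lemma adj_carrier [simp, intro]: "A \<in> carrier_mat nr nc \<Longrightarrow> adj A \<in> carrier_mat nc nr"
  by (auto simp: adj_def)

lemma dim_adj [simp]: "dim_row (adj A) = dim_col A" "dim_col (adj A) = dim_row A"
  by (auto simp: adj_def)

lemma index_adj [simp]:
  "i < dim_col A \<Longrightarrow> j < dim_row A \<Longrightarrow> adj A $$ (i, j) = cnj (A $$ (j, i))"
  by (auto simp: adj_def)

lemma adj_adj [simp]: "adj (adj A) = A"
  by (rule eq_matI) auto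

lemma adj_one [simp]: "adj (1\<^sub>m n) = 1\<^sub>m n"
  by (rule eq_matI) auto

lemma index_mult_sum:
  assumes "A \<in> carrier_mat nr n" "B \<in> carrier_mat n nc" "i < nr" "j < nc"
  shows "(A * B) $$ (i, j) = (\<Sum>k<n. A $$ (i, k) * B $$ (k, j))"
  using assms by (auto simp: scalar_prod_def lessThan_atLeast0 intro!: sum.cong)

lemma adj_mult:
  assumes "A \<in> carrier_mat nr n" "B \<in> carrier_mat n nc"
  shows "adj (A * B) = adj B * adj A"
proof (rule eq_matI)
  fix i j assume "i < dim_row (adj B * adj A)" "j < dim_col (adj B * adj A)"
  then have ij: "i < nc" "j < nr" using assms by auto
  show "adj (A * B) $$ (i, j) = (adj B * adj A) $$ (i, j)"
    using assms ij
    by (subst index_mult_sum[OF adj_carrier[OF assms(2)] adj_carrier[OF assms(1)]])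
      (auto simp: index_mult_sum[OF assms] cnj_sum mult.commute simp del: index_mult_mat(1)
        intro!: sum.cong)
qed (use assms in auto)

lemma mult_carrier_square [simp]:
  "A \<in> carrier_mat n n \<Longrightarrow> B \<in> carrier_mat n n \<Longrightarrow> A * B \<in> carrier_mat n n"
  by (rule mult_carrier_mat)

lemma det_adj:
  assumes "A \<in> carrier_mat n n"
  shows "det (adj A) = cnj (det A)"
proof -
  have "adj A = map_mat cnj (transpose_mat A)"
    by (rule eq_matI) auto
  moreover have "det (map_mat cnj (transpose_mat A)) = cnj (det (transpose_mat A))"
    using assms by (auto simp: det_def cnj_sum cnj_prod intro!: sum.cong prod.cong)
  ultimately show ?thesis using det_transpose[OF assms] by simp
qed

section \<open>Unitary matrices and unitary similarity\<close>

lemma unitaryD: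
  assumes "unitary n U"
  shows "U \<in> carrier_mat n n" "adj U \<in> carrier_mat n n"
    "U * adj U = 1\<^sub>m n" "adj U * U = 1\<^sub>m n"
  using assms mat_mult_left_right_inverse[of U n "adj U"] by (auto simp: unitary_def)

lemma unitary_adj: "unitary n U \<Longrightarrow> unitary n (adj U)"
  by (auto simp: unitary_def[of n "adj U"] dest: unitaryD)

lemma unitary_mult:
  assumes "unitary n U" "unitary n V"
  shows "unitary n (U * V)"
proof -
  note U = unitaryD[OF assms(1)] note V = unitaryD[OF assms(2)]
  note [simp] = assoc_mult_mat[of _ n n _ n _ n]
  have "U * V * adj (U * V) = U * (V * adj V) * adj U"
    using U(1,2) V(1,2) by (simp add: adj_mult[of _ n n _ n])
  also have "\<dots> = 1\<^sub>m n" using U V by simp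
  finally show ?thesis using U V by (simp add: unitary_def)
qed

lemma unitary_one: "unitary n (1\<^sub>m n)"
  by (simp add: unitary_def)

lemma unitary_conj_swap:
  assumes "unitary n U" "A \<in> carrier_mat n n" "B \<in> carrier_mat n n"
  shows "adj U * A * U = B \<longleftrightarrow> A = U * B * adj U"
proof
  note U = unitaryD[OF assms(1)]
  note [simp] = assoc_mult_mat[of _ n n _ n _ n]
  show "A = U * B * adj U" if "adj U * A * U = B"
  proof -
    have "U * B * adj U = (U * adj U) * A * (U * adj U)"
      unfolding that[symmetric] using U(1,2) assms(2) by simp
    then show ?thesis using U assms by simp
  qed
  show "adj U * A * U = B" if "A = U * B * adj U"
  proof -
    have "adj U * A * U = (adj U * U) * B * (adj U * U)"
      unfolding that using U(1,2) assms(3) by simp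
    then show ?thesis using U assms by simp
  qed
qed

text \<open>The Householder reflection exchanging \<open>v\<close> with the first unit vector.\<close>

lemma reflection_exists:
  fixes v :: "nat \<Rightarrow> complex"
  assumes n: "0 < n" and unit: "(\<Sum>k<n. v k * cnj (v k)) = 1" and real: "cnj (v 0) = v 0"
  shows "\<exists>H. unitary n H \<and> adj H = H \<and> (\<forall>i<n. H $$ (i, 0) = v i)"
proof -
  define w where "w i = v i - of_bool (i = 0)" for i
  define s where "s = (\<Sum>k<n. w k * cnj (w k))"
  \<comment> \<open>The Householder coefficient 2 / |w|^2. If \<open>v\<close> already is the first
    unit vector, then \<open>s = 0\<close>, division by zero gives \<open>c = 0\<close>, and
    \<open>H\<close> is the identity; the relation \<open>cs\<close> survives this case.\<close>
  define c where "c = 2 / s"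
  define H where "H = mat n n (\<lambda>(i, j). of_bool (i = j) - c * w i * cnj (w j))"
  have H: "H \<in> carrier_mat n n" by (simp add: H_def)
  have cnj_s: "cnj s = s" by (simp add: s_def mult.commute)
  then have cnj_c: "cnj c = c" by (simp add: c_def)
  have cs: "c * c * s = 2 * c" by (simp add: c_def)
  have adjH: "adj H = H"
    by (rule eq_matI) (auto simp: H_def adj_def cnj_c mult.commute mult.left_commute)
  have "s = (\<Sum>k<n. v k * cnj (v k) - (if k = 0 then v 0 + cnj (v 0) - 1 else 0))"
    unfolding s_def w_def by (rule sum.cong) (auto simp: algebra_simps)
  also have "\<dots> = 2 - 2 * v 0"
    using n by (simp add: sum_subtractf unit real)
  finally have s: "s = 2 - 2 * v 0" .
  have "H * H = 1\<^sub>m n"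
  proof (rule eq_matI)
    fix i j assume "i < dim_row (1\<^sub>m n)" "j < dim_col (1\<^sub>m n)"
    then have ij: "i < n" "j < n" by auto
    have "(H * H) $$ (i, j) = (\<Sum>k<n. (of_bool (i = k) - c * w i * cnj (w k)) *
        (of_bool (k = j) - c * w k * cnj (w j)))"
      using ij by (subst index_mult_sum[OF H H]) (auto simp: H_def)
    also have "\<dots> = (\<Sum>k<n. (if k = i then of_bool (i = j) else 0)
        - (if k = i then c * w i * cnj (w j) else 0)
        - (if k = j then c * w i * cnj (w j) else 0)
        + c * c * w i * cnj (w j) * (w k * cnj (w k)))"
      by (rule sum.cong) (auto simp: algebra_simps)
    also have "\<dots> = of_bool (i = j) - 2 * c * w i * cnj (w j) + (c * c * s) * w i * cnj (w j)"
      using ij by (simp add: sum.distrib sum_subtractf s_def sum_distrib_left[symmetric])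
    also have "\<dots> = of_bool (i = j)" by (simp add: cs)
    finally show "(H * H) $$ (i, j) = 1\<^sub>m n $$ (i, j)" using ij by simp
  qed (use H in auto)
  moreover have "H $$ (i, 0) = v i" if i: "i < n" for i
  proof -
    have "H $$ (i, 0) = of_bool (i = 0) - c * w i * cnj (w 0)" using i n by (simp add: H_def)
    \<comment> \<open>Here the realness of \<open>v 0\<close> matters: for nonzero \<open>s\<close>
      it makes \<open>c * cnj (w 0)\<close> equal to -1, so that \<open>H\<close> sends the first
      unit vector e to e + w = v.\<close>
    also have "cnj (w 0) = - s / 2" by (simp add: w_def real s)
    also have "of_bool (i = 0) - c * w i * (- s / 2) = v i"
    proof (cases "s = 0")
      case True
      have "(\<Sum>k<n. (cmod (w k))\<^sup>2) = 0"
      proof -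
        have "complex_of_real (\<Sum>k<n. (cmod (w k))\<^sup>2) = s"
          unfolding s_def of_real_sum by (rule sum.cong) (auto simp: mult_cnj_cmod)
        then show ?thesis using True by (metis of_real_eq_0_iff)
      qed
      then have "w i = 0" using i by (subst (asm) sum_nonneg_eq_0_iff) auto
      then show ?thesis by (simp add: w_def)
    next
      case False
      then have "c * w i * (- s / 2) = - w i" by (simp add: c_def)
      then show ?thesis by (simp add: w_def)
    qed
    finally show ?thesis .
  qed
  ultimately show ?thesis using H adjH by (intro exI[of _ H]) (simp add: unitary_def)
qed

lemma unit_eigenvector_exists:
  fixes A :: "complex mat"
  assumes A: "A \<in> carrier_mat n n" and e: "eigenvalue A e"
  obtains u where "u \<in> carrier_vec n" "A *\<^sub>v u = e \<cdot>\<^sub>v u"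
    "(\<Sum>k<n. u $ k * cnj (u $ k)) = 1" "cnj (u $ 0) = u $ 0" "0 < n"
proof -
  obtain v where v: "v \<in> carrier_vec n" "v \<noteq> 0\<^sub>v n" "A *\<^sub>v v = e \<cdot>\<^sub>v v"
    using e A by (auto simp: eigenvalue_def eigenvector_def)
  define r where "r = (\<Sum>k<n. (cmod (v $ k))\<^sup>2)"
  \<comment> \<open>A phase of modulus 1 that rotates the first entry onto the nonnegative reals, as
    \<open>reflection_exists\<close> requires. If that entry is 0, any phase will do.\<close>
  define t where "t = (if v $ 0 = 0 then 1 else cnj (v $ 0) / cmod (v $ 0))"
  define z where "z = t / sqrt r"
  have n: "0 < n"
    using v by (metis carrier_vecD eq_vecI gr_zeroI index_zero_vec(2) not_less_zero)
  have "\<exists>k<n. v $ k \<noteq> 0"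
    using v by (metis carrier_vecD eq_vecI index_zero_vec)
  then have r: "0 < r" unfolding r_def
    by (metis (no_types, lifting) finite_lessThan lessThan_iff sum_pos2 zero_le_power2 zero_less_norm_iff zero_less_power)
  have t: "t * cnj t = 1"
    unfolding mult_cnj_cmod by (simp add: t_def norm_divide)
  have t0: "cnj (t * v $ 0) = t * v $ 0"
    by (auto simp: t_def mult.commute)
  show thesis
  proof
    show "z \<cdot>\<^sub>v v \<in> carrier_vec n" using v by simp
    show "A *\<^sub>v (z \<cdot>\<^sub>v v) = e \<cdot>\<^sub>v (z \<cdot>\<^sub>v v)"
      using v A by (auto simp: mult_mat_vec[OF A] smult_smult_assoc mult.commute)
    have "(\<Sum>k<n. (z \<cdot>\<^sub>v v) $ k * cnj ((z \<cdot>\<^sub>v v) $ k)) = (\<Sum>k<n. (cmod (v $ k))\<^sup>2 / r)"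
      unfolding of_real_sum
    proof (rule sum.cong)
      fix k assume k: "k \<in> {..<n}"
      have "(z \<cdot>\<^sub>v v) $ k * cnj ((z \<cdot>\<^sub>v v) $ k) = (z * cnj z) * (v $ k * cnj (v $ k))"
        using k v by simp
      also have "z * cnj z = (t * cnj t) / (complex_of_real (sqrt r) * complex_of_real (sqrt r))"
        by (simp add: z_def)
      also have "complex_of_real (sqrt r) * complex_of_real (sqrt r) = complex_of_real r"
        using r by (simp flip: of_real_mult)
      finally show "(z \<cdot>\<^sub>v v) $ k * cnj ((z \<cdot>\<^sub>v v) $ k) = complex_of_real ((cmod (v $ k))\<^sup>2 / r)"
        using r t by (simp add: mult_cnj_cmod)
    qed simp
    also have "\<dots> = 1" using r by (simp add: sum_divide_distrib[symmetric] r_def)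
    finally show "(\<Sum>k<n. (z \<cdot>\<^sub>v v) $ k * cnj ((z \<cdot>\<^sub>v v) $ k)) = 1" .
    show "cnj ((z \<cdot>\<^sub>v v) $ 0) = (z \<cdot>\<^sub>v v) $ 0"
      using v n t0 by (simp add: z_def)
    show "0 < n" by (rule n)
  qed
qed

lemma four_block_unitary:
  assumes "unitary n U"
  shows "unitary (Suc n) (four_block_mat (1\<^sub>m 1) (0\<^sub>m 1 n) (0\<^sub>m n 1) U)"
    (is "unitary _ ?V")
proof -
  note U = unitaryD[OF assms]
  have adjV: "adj ?V = four_block_mat (1\<^sub>m 1) (0\<^sub>m 1 n) (0\<^sub>m n 1) (adj U)"
    using U by (intro eq_matI) auto
  have "?V * adj ?V = four_block_mat (1\<^sub>m 1) (0\<^sub>m 1 n) (0\<^sub>m n 1) (1\<^sub>m n)"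
    unfolding adjV using U
    by (subst mult_four_block_mat[of _ 1 1 _ n _ n _ _ 1 _ n]) auto
  then show ?thesis using U by (auto simp: unitary_def)
qed

text \<open>Deflation: a reflection whose first column is a unit eigenvector for \<open>e\<close>
  splits off \<open>e\<close>, and the remaining block has the characteristic polynomial with one
  linear factor cancelled. The list \<open>es\<close> prescribes the order on the diagonal; Weyl's
  inequality needs this control to read off the leading eigenvalues.\<close>

theorem unitary_schur:
  fixes A :: "complex mat"
  assumes "A \<in> carrier_mat n n" "char_poly A = (\<Prod>e\<leftarrow>es. [:- e, 1:])"
  shows "\<exists>U. unitary n U \<and> upper_triangular (adj U * A * U) \<and> diag_mat (adj U * A * U) = es"
  using assms
proof (induction es arbitrary: n A)
  case Nil
  then have "n = 0" using degree_monic_char_poly[of A n] by simp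
  then show ?case using Nil
    by (intro exI[of _ "1\<^sub>m 0"]) (auto simp: unitary_one diag_mat_def)
next
  case (Cons e es)
  note A = Cons.prems(1)
  have "eigenvalue A e"
    unfolding eigenvalue_root_char_poly[OF A] Cons.prems(2) by simp
  then obtain u where u: "u \<in> carrier_vec n" "A *\<^sub>v u = e \<cdot>\<^sub>v u"
    "(\<Sum>k<n. u $ k * cnj (u $ k)) = 1" "cnj (u $ 0) = u $ 0" and n: "0 < n"
    using unit_eigenvector_exists[OF A] by metis
  obtain H where H: "unitary n H" "adj H = H" and col: "\<forall>i<n. H $$ (i, 0) = u $ i"
    using reflection_exists[of n "($) u"] u n by blast
  obtain p where p: "n = Suc p" using n by (cases n) auto
  note HU = unitaryD[OF H(1)]
  define A' where "A' = H * A * H"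
  have A': "A' \<in> carrier_mat n n" using A HU by (simp add: A'_def)
  have colH: "col H 0 = u" using col HU(1) u(1) n by (intro eq_vecI) auto
  have HH: "H * H = 1\<^sub>m n" using HU H(2) by simp
  \<comment> \<open>\<open>H\<close> is an involution with first column \<open>u\<close>, so
    \<open>H\<close> maps \<open>u\<close> back to the first unit vector.\<close>
  have "col A' 0 = H *\<^sub>v (A *\<^sub>v u)"
    unfolding A'_def using A HU(1) n
    by (subst col_mult2[of _ n n _ n]) (auto simp: colH u(1) assoc_mult_mat_vec[of _ n n _ n])
  also have "\<dots> = e \<cdot>\<^sub>v (H *\<^sub>v u)" using HU(1) u by (simp add: mult_mat_vec[of _ n n])
  also have "H *\<^sub>v u = col (H * H) 0"
    using HU(1) n by (subst col_mult2[of _ n n _ n]) (auto simp: colH)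
  also have "\<dots> = unit_vec n 0" using n by (simp add: HH)
  finally have colA': "col A' 0 = e \<cdot>\<^sub>v unit_vec n 0" .
  have A'0: "A' $$ (i, 0) = (if i = 0 then e else 0)" if "i < n" for i
    using arg_cong[OF colA', of "\<lambda>v. v $ i"] A' that n by auto
  define A2 where "A2 = mat 1 p (\<lambda>(i, j). A' $$ (0, Suc j))"
  define A3 where "A3 = mat p p (\<lambda>(i, j). A' $$ (Suc i, Suc j))"
  define A1 where "A1 = mat 1 1 (\<lambda>(i, j). e)"
  have cA: "A1 \<in> carrier_mat 1 1" "A2 \<in> carrier_mat 1 p" "A3 \<in> carrier_mat p p"
    by (auto simp: A1_def A2_def A3_def)
  have blk: "A' = four_block_mat A1 A2 (0\<^sub>m p 1) A3"
    using A' p A'0 by (intro eq_matI) (auto simp: A1_def A2_def A3_def)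
  have "A = H * A' * H"
    using unitary_conj_swap[OF H(1) A A'] H(2) by (simp add: A'_def)
  then have "similar_mat A A'"
    unfolding similar_mat_def
    by (intro exI[of _ H] similar_mat_witI[of _ _ n]) (use A A' HH HU(1) in simp_all)
  then have "char_poly A = char_poly A1 * char_poly A3"
    using char_poly_similar char_poly_four_block_zeros_col[OF cA] blk by metis
  moreover have "char_poly A1 = [:- e, 1:]"
    by (subst char_poly_upper_triangular[OF cA(1)]) (auto simp: A1_def diag_mat_def)
  ultimately have "[:- e, 1:] * char_poly A3 = [:- e, 1:] * (\<Prod>e\<leftarrow>es. [:- e, 1:])"
    using Cons.prems(2) by simp
  then have "char_poly A3 = (\<Prod>e\<leftarrow>es. [:- e, 1:])"
    by (subst (asm) mult_left_cancel) auto
  from Cons.IH[OF cA(3) this] obtain V where V: "unitary p V"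
    "upper_triangular (adj V * A3 * V)" "diag_mat (adj V * A3 * V) = es" by blast
  note VU = unitaryD[OF V(1)]
  define W where "W = four_block_mat (1\<^sub>m 1) (0\<^sub>m 1 p) (0\<^sub>m p 1) V"
  have W: "unitary n W" using four_block_unitary[OF V(1)] by (simp add: W_def p)
  note WU = unitaryD[OF W]
  have adjW: "adj W = four_block_mat (1\<^sub>m 1) (0\<^sub>m 1 p) (0\<^sub>m p 1) (adj V)"
    using VU by (intro eq_matI) (auto simp: W_def)
  have T: "adj W * A' * W = four_block_mat A1 (A2 * V) (0\<^sub>m p 1) (adj V * A3 * V)"
    unfolding adjW blk unfolding W_def using VU cA
    by (simp add: mult_four_block_mat[of _ 1 1 _ p _ p _ _ 1 _ p])
  have eq: "adj (H * W) * A * (H * W) = adj W * A' * W"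
    using HU(1) WU(1,2) A
    by (simp add: adj_mult[of _ n n _ n] H(2) A'_def assoc_mult_mat[of _ n n _ n _ n])
  have cV: "adj V * A3 * V \<in> carrier_mat p p" using VU cA by simp
  have "upper_triangular (adj W * A' * W)"
    unfolding T by (rule upper_triangular_four_block[OF cA(1) cV _ V(2)]) (auto simp: A1_def)
  moreover have "diag_mat (adj W * A' * W) = e # es"
    unfolding T by (subst diag_four_block_mat[OF cA(1) cV]) (simp add: V(3), simp add: A1_def diag_mat_def)
  ultimately show ?case
    using unitary_mult[OF H(1) W] eq by (intro exI[of _ "H * W"]) simp
qed

text \<open>Normality equates the norm of row i with the norm of column i. Once the earlier rows are
  known to be diagonal, column i consists of its diagonal entry alone, which leaves no room in row
  i.\<close>

lemma normal_triangular_diagonal: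
  fixes T :: "complex mat"
  assumes T: "T \<in> carrier_mat n n" "upper_triangular T" and normal: "T * adj T = adj T * T"
  shows "i < j \<Longrightarrow> j < n \<Longrightarrow> T $$ (i, j) = 0"
proof (induction i arbitrary: j rule: less_induct)
  case (less i)
  then have i: "i < n" by simp
  have "(T * adj T) $$ (i, i) = (\<Sum>k<n. (cmod (T $$ (i, k)))\<^sup>2)"
    using T i unfolding of_real_sum
    by (subst index_mult_sum[OF T(1) adj_carrier[OF T(1)]]) (auto simp: mult_cnj_cmod intro!: sum.cong)
  \<comment> \<open>In column i the entries above the diagonal vanish by induction, those below it
    by triangularity.\<close>
  moreover have "(adj T * T) $$ (i, i) = (\<Sum>k<n. if k = i then (cmod (T $$ (i, i)))\<^sup>2 else 0)"
    unfolding of_real_sum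
  proof (subst index_mult_sum[OF adj_carrier[OF T(1)] T(1) i i], rule sum.cong)
    fix k assume k: "k \<in> {..<n}"
    have "k < i \<Longrightarrow> T $$ (k, i) = 0" using less.IH[of k i] i by simp
    moreover have "i < k \<Longrightarrow> T $$ (k, i) = 0" using T k by (auto simp: upper_triangular_def)
    ultimately show "adj T $$ (i, k) * T $$ (k, i) =
        complex_of_real (if k = i then (cmod (T $$ (i, i)))\<^sup>2 else 0)"
      using T i k by (cases k i rule: linorder_cases) (auto simp: mult_cnj_cmod mult.commute[of "cnj _"])
  qed simp
  ultimately have "complex_of_real (\<Sum>k<n. (cmod (T $$ (i, k)))\<^sup>2) =
      complex_of_real (\<Sum>k<n. if k = i then (cmod (T $$ (i, i)))\<^sup>2 else 0)"
    unfolding normal by (rule trans[OF sym])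
  then have "(\<Sum>k<n. (cmod (T $$ (i, k)))\<^sup>2) = (cmod (T $$ (i, i)))\<^sup>2"
    unfolding of_real_eq_iff using i by simp
  then have "(\<Sum>k\<in>{..<n} - {i}. (cmod (T $$ (i, k)))\<^sup>2) = 0"
    using i by (subst (asm) sum.remove[of _ i]) auto
  then show ?case using less.prems by (subst (asm) sum_nonneg_eq_0_iff) auto
qed

lemma rdiag_carrier [simp]: "rdiag ls \<in> carrier_mat (length ls) (length ls)"
  by (simp add: rdiag_def)

lemma dim_rdiag [simp]: "dim_row (rdiag ls) = length ls" "dim_col (rdiag ls) = length ls"
  by (auto simp: rdiag_def)

lemma index_rdiag [simp]: "i < length ls \<Longrightarrow> j < length ls \<Longrightarrow>
    rdiag ls $$ (i, j) = (if i = j then complex_of_real (ls ! i) else 0)"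
  by (simp add: rdiag_def)

lemma adj_rdiag [simp]: "adj (rdiag ls) = rdiag ls"
  by (rule eq_matI) auto

lemma adj_conj:
  assumes "U \<in> carrier_mat n k" "A \<in> carrier_mat n n"
  shows "adj (adj U * A * U) = adj U * adj A * U"
proof -
  have "adj (adj U * A * U) = adj U * adj (adj U * A)"
    using assms by (intro adj_mult[of _ k n _ k]) auto
  also have "adj (adj U * A) = adj A * U"
    using assms by (subst adj_mult[of _ k n _ n]) auto
  finally show ?thesis using assms by (simp add: assoc_mult_mat[of _ k n _ n _ k])
qed

text \<open>Two commuting Hermitian matrices are the real and imaginary part of a normal matrix.\<close>

theorem simultaneous_diagonalization:
  assumes A: "A \<in> carrier_mat n n" "adj A = A" and B: "B \<in> carrier_mat n n" "adj B = B"
    and comm: "A * B = B * A"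
  shows "\<exists>U as bs. unitary n U \<and> length as = n \<and> length bs = n \<and>
    A = U * rdiag as * adj U \<and> B = U * rdiag bs * adj U"
proof -
  define Z where "Z = A + \<i> \<cdot>\<^sub>m B"
  have Z: "Z \<in> carrier_mat n n" using A B by (simp add: Z_def)
  have adjZ: "adj Z = A + (- \<i>) \<cdot>\<^sub>m B"
  proof (rule eq_matI)
    fix i j assume "i < dim_row (A + (- \<i>) \<cdot>\<^sub>m B)" "j < dim_col (A + (- \<i>) \<cdot>\<^sub>m B)"
    then have ij: "i < n" "j < n" using A B by auto
    have "cnj (A $$ (j, i)) = A $$ (i, j)" "cnj (B $$ (j, i)) = B $$ (i, j)"
      using A B ij index_adj[of i A j] index_adj[of i B j] by auto
    then show "adj Z $$ (i, j) = (A + (- \<i>) \<cdot>\<^sub>m B) $$ (i, j)"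
      using A B ij by (simp add: Z_def)
  qed (use A B in \<open>auto simp: Z_def\<close>)
  obtain es where "char_poly Z = (\<Prod>e\<leftarrow>es. [:- e, 1:])"
    using char_poly_factorized[OF Z] by blast
  from unitary_schur[OF Z this] obtain U where U: "unitary n U"
    and tri: "upper_triangular (adj U * Z * U)" by blast
  note UU = unitaryD[OF U]
  note [simp] = assoc_mult_mat[of _ n n _ n _ n]
  define T where "T = adj U * Z * U"
  have T: "T \<in> carrier_mat n n" using UU Z by (simp add: T_def)
  have dec: "adj U * Z * U = adj U * A * U + \<i> \<cdot>\<^sub>m (adj U * B * U)"
    unfolding Z_def using UU A B
    by (simp add: add_mult_distrib_mat[of _ n n _ _ n] mult_add_distrib_mat[of _ n n _ n]
        mult_smult_distrib[of _ n n] mult_smult_assoc_mat[of _ n n])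
  have adjT: "adj T = adj U * adj Z * U"
    unfolding T_def using UU Z by (intro adj_conj) auto
  \<comment> \<open>Commutativity enters here: the two products differ by a multiple of AB -
    BA.\<close>
  have ZZ: "Z * adj Z = adj Z * Z"
    unfolding adjZ unfolding Z_def using A B comm
    by (simp add: add_mult_distrib_mat[of _ n n _ _ n] mult_add_distrib_mat[of _ n n _ n]
        mult_smult_distrib[of _ n n] mult_smult_assoc_mat[of _ n n])
      (intro eq_matI, auto simp: algebra_simps simp del: index_mult_mat(1))
  have conjm: "(adj U * X * U) * (adj U * Y * U) = adj U * (X * Y) * U"
    if "X \<in> carrier_mat n n" "Y \<in> carrier_mat n n" for X Y
  proof -
    have "(adj U * X * U) * (adj U * Y * U) = adj U * X * (U * adj U) * Y * U"
      using UU(1,2) that by simp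
    then show ?thesis using UU that by simp
  qed
  have "T * adj T = adj T * T"
    unfolding adjT unfolding T_def using Z by (simp only: conjm ZZ adj_carrier)
  note diag = normal_triangular_diagonal[OF T tri[folded T_def] this]
  define A' B' where "A' = adj U * A * U" and "B' = adj U * B * U"
  have c: "A' \<in> carrier_mat n n" "B' \<in> carrier_mat n n" using UU A B by (auto simp: A'_def B'_def)
  have "adj A' = A'" "adj B' = B'"
    unfolding A'_def B'_def using adj_conj[OF UU(1) A(1)] adj_conj[OF UU(1) B(1)] A(2) B(2) by auto
  then have h: "cnj (A' $$ (i, j)) = A' $$ (j, i)" "cnj (B' $$ (i, j)) = B' $$ (j, i)"
    if "i < n" "j < n" for i j
    using c that index_adj[of j A' i] index_adj[of j B' i] by auto
  have T': "T $$ (i, j) = A' $$ (i, j) + \<i> * B' $$ (i, j)" if "i < n" "j < n" for i j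
    using that c unfolding T_def dec A'_def[symmetric] B'_def[symmetric] by simp
  have T0: "T $$ (i, j) = 0" if "i < n" "j < n" "i \<noteq> j" for i j
  proof (cases "i < j")
    case True then show ?thesis using diag that by blast
  next
    case False then show ?thesis using tri that T by (auto simp: T_def[symmetric] upper_triangular_def)
  qed
  \<comment> \<open>Diagonality of \<open>T\<close> kills A' + iB' off the diagonal. Conjugating the
    transposed entry, with both matrices Hermitian, kills A' - iB' as well, hence each part
    separately.\<close>
  have off: "A' $$ (i, j) = 0 \<and> B' $$ (i, j) = 0" if ij: "i < n" "j < n" "i \<noteq> j" for i j
  proof -
    have 1: "A' $$ (i, j) + \<i> * B' $$ (i, j) = 0" using T0[of i j] T'[of i j] ij by simp
    have "A' $$ (j, i) + \<i> * B' $$ (j, i) = 0" using T0[of j i] T'[of j i] ij by simp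
    then have "cnj (A' $$ (j, i) + \<i> * B' $$ (j, i)) = 0" by (simp only: complex_cnj_zero)
    then have 2: "A' $$ (i, j) - \<i> * B' $$ (i, j) = 0" using h[of j i] ij by simp
    have "2 * A' $$ (i, j) = (A' $$ (i, j) + \<i> * B' $$ (i, j)) + (A' $$ (i, j) - \<i> * B' $$ (i, j))"
      by simp
    also have "\<dots> = 0" unfolding 1 2 by simp
    finally have "A' $$ (i, j) = 0" by simp
    with 1 show ?thesis by simp
  qed
  have diagform: "X = U * rdiag (map (\<lambda>i. Re ((adj U * X * U) $$ (i, i))) [0..<n]) * adj U"
    if X: "X \<in> carrier_mat n n" and "adj X = X"
      and off: "\<And>i j. i < n \<Longrightarrow> j < n \<Longrightarrow> i \<noteq> j \<Longrightarrow> (adj U * X * U) $$ (i, j) = 0" for X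
  proof -
    define M where "M = adj U * X * U"
    have M: "M \<in> carrier_mat n n" using UU X by (simp add: M_def)
    have "adj M = M" using adj_conj[OF UU(1) X] that(2) by (simp add: M_def)
    then have "cnj (M $$ (i, i)) = M $$ (i, i)" if "i < n" for i
      using M that index_adj[of i M i] by simp
    then have re: "complex_of_real (Re (M $$ (i, i))) = M $$ (i, i)" if "i < n" for i
      using that by (simp add: complex_eq_iff)
    have "M = rdiag (map (\<lambda>i. Re (M $$ (i, i))) [0..<n])"
    proof (rule eq_matI)
      fix i j assume "i < dim_row (rdiag (map (\<lambda>i. Re (M $$ (i, i))) [0..<n]))"
        "j < dim_col (rdiag (map (\<lambda>i. Re (M $$ (i, i))) [0..<n]))"
      then have "i < n" "j < n" by simp_all
      then show "M $$ (i, j) = rdiag (map (\<lambda>i. Re (M $$ (i, i))) [0..<n]) $$ (i, j)"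
        using re off[of i j, folded M_def] by simp
    qed (use M in simp_all)
    then have *: "adj U * X * U = rdiag (map (\<lambda>i. Re ((adj U * X * U) $$ (i, i))) [0..<n])"
      unfolding M_def .
    have "rdiag (map (\<lambda>i. Re ((adj U * X * U) $$ (i, i))) [0..<n]) \<in> carrier_mat n n"
      by (simp add: rdiag_def)
    from iffD1[OF unitary_conj_swap[OF U X this] *] show ?thesis .
  qed
  let ?d = "\<lambda>X. map (\<lambda>i. Re ((adj U * X * U) $$ (i, i))) [0..<n]"
  have "A = U * rdiag (?d A) * adj U" "B = U * rdiag (?d B) * adj U"
    using diagform[OF A] diagform[OF B] off[unfolded A'_def B'_def] by blast+
  moreover have "length (?d A) = n" "length (?d B) = n" by simp_all
  ultimately show ?thesis using U by blast
qed

text \<open>\<open>simultaneous_diagonalization\<close> gives no control over the order of the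
  eigenvalues. The ordered triangularization does, and a Hermitian triangular matrix is
  diagonal.\<close>

lemma spectral_theorem_ordered:
  assumes A: "A \<in> carrier_mat n n" "adj A = A"
    and cp: "char_poly A = (\<Prod>l\<leftarrow>ls. [:- complex_of_real l, 1:])"
  shows "\<exists>U. unitary n U \<and> length ls = n \<and> A = U * rdiag ls * adj U"
proof -
  have "char_poly A = (\<Prod>e\<leftarrow>map complex_of_real ls. [:- e, 1:])"
    using cp by (simp add: o_def)
  from unitary_schur[OF A(1) this] obtain U where U: "unitary n U"
    and tri: "upper_triangular (adj U * A * U)"
    and dg: "diag_mat (adj U * A * U) = map complex_of_real ls" by blast
  note UU = unitaryD[OF U]
  define T where "T = adj U * A * U"
  have T: "T \<in> carrier_mat n n" using UU A by (simp add: T_def)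
  have adjT: "adj T = T" using adj_conj[OF UU(1) A(1)] A(2) by (simp add: T_def)
  have "length (diag_mat T) = n" using T by (simp add: diag_mat_def)
  then have len: "length ls = n" by (simp add: dg[folded T_def])
  have d: "T $$ (i, i) = complex_of_real (ls ! i)" if "i < n" for i
    using arg_cong[OF dg[folded T_def], of "\<lambda>l. l ! i"] that T len by (simp add: diag_mat_def)
  have lo: "T $$ (i, j) = 0" if "j < i" "i < n" for i j
    using tri that T by (auto simp: T_def[symmetric] upper_triangular_def)
  have up: "T $$ (i, j) = 0" if "i < j" "j < n" for i j
    using lo[OF that] index_adj[of i T j] adjT that T by auto
  have "T = rdiag ls"
  proof (rule eq_matI)
    fix i j assume "i < dim_row (rdiag ls)" "j < dim_col (rdiag ls)"
    then show "T $$ (i, j) = rdiag ls $$ (i, j)"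
      using d lo up len by (cases i j rule: linorder_cases) auto
  qed (use T len in auto)
  then have "adj U * A * U = rdiag ls" by (simp add: T_def)
  moreover have "rdiag ls \<in> carrier_mat n n" using rdiag_carrier[of ls] len by simp
  ultimately have "A = U * rdiag ls * adj U" using unitary_conj_swap[OF U A(1)] by blast
  then show ?thesis using U len by blast
qed

subsection \<open>Eigenvalues of Hermitian matrices\<close>

text \<open>The multiset \<open>proots\<close> of complex roots recovers the list up to order, and
  \<open>Re\<close> undoes the embedding of the reals.\<close>

lemma mset_eq_of_prod_linear_eq:
  fixes ls ks :: "real list"
  assumes "(\<Prod>l\<leftarrow>ls. [:- complex_of_real l, 1:]) = (\<Prod>l\<leftarrow>ks. [:- complex_of_real l, 1:])"
  shows "mset ls = mset ks"
proof -
  have "proots (\<Prod>l\<leftarrow>xs. [:- complex_of_real l, 1:]) = image_mset complex_of_real (mset xs)"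
    for xs :: "real list"
  proof (induction xs)
    case (Cons x xs)
    have "(\<Prod>l\<leftarrow>xs. [:- complex_of_real l, 1:]) \<noteq> 0" by (auto simp: prod_list_zero_iff)
    then show ?case
      using Cons by (subst list.map(2), subst prod_list.Cons, subst proots_mult) auto
  qed simp
  then have "image_mset complex_of_real (mset ls) = image_mset complex_of_real (mset ks)"
    using assms by metis
  moreover have "image_mset Re (image_mset complex_of_real M) = M" for M
    by (simp add: multiset.map_comp o_def)
  ultimately show ?thesis by metis
qed

lemma prod_list_map_mset_cong:
  fixes f :: "'a \<Rightarrow> 'b::comm_monoid_mult"
  assumes "mset xs = mset ys"
  shows "prod_list (map f xs) = prod_list (map f ys)"
  using assms prod_mset_prod_list[of "map f xs"] prod_mset_prod_list[of "map f ys"] by simp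

lemma sort_sorted_wrt_ge:
  fixes ls :: "'a::linorder list"
  assumes "sorted_wrt (\<ge>) ls"
  shows "rev (sort ls) = ls"
proof -
  have "sorted (rev ls)" using assms by (simp add: sorted_wrt_rev)
  then have "sort ls = rev ls" by (intro properties_for_sort) auto
  then show ?thesis by simp
qed

text \<open>Shows that the choice in \<open>eigs\<close> is forced: the polynomial fixes the
  multiset, and sorting fixes the list.\<close>

lemma eigs_eqI:
  assumes "sorted_wrt (\<ge>) ls" "char_poly A = (\<Prod>l\<leftarrow>ls. [:- complex_of_real l, 1:])"
  shows "eigs A = ls"
  unfolding eigs_def
proof (rule some_equality)
  fix ks assume ks: "sorted_wrt (\<ge>) ks \<and> char_poly A = (\<Prod>l\<leftarrow>ks. [:- complex_of_real l, 1:])"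
  then have "mset ks = mset ls" using assms(2) mset_eq_of_prod_linear_eq by metis
  then have "sort ks = sort ls" by (metis properties_for_sort mset_sort sorted_sort)
  then show "ks = ls" using ks assms(1) sort_sorted_wrt_ge by metis
qed (use assms in auto)

lemma eigs_cong: "char_poly A = char_poly B \<Longrightarrow> eigs A = eigs B"
  by (simp add: eigs_def)

lemma char_poly_rdiag: "char_poly (rdiag ls) = (\<Prod>l\<leftarrow>ls. [:- complex_of_real l, 1:])"
proof -
  have "upper_triangular (rdiag ls)" by (auto simp: upper_triangular_def)
  moreover have "diag_mat (rdiag ls) = map complex_of_real ls"
    by (rule nth_equalityI) (auto simp: diag_mat_def)
  ultimately show ?thesis
    using char_poly_upper_triangular[OF rdiag_carrier] by (simp add: o_def)
qed

lemma det_rdiag: "det (rdiag ls) = complex_of_real (prod_list ls)"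
proof -
  have "upper_triangular (rdiag ls)" by (auto simp: upper_triangular_def)
  moreover have "diag_mat (rdiag ls) = map complex_of_real ls"
    by (rule nth_equalityI) (auto simp: diag_mat_def)
  moreover have "prod_list (map complex_of_real ls) = complex_of_real (prod_list ls)"
    by (induction ls) auto
  ultimately show ?thesis
    using det_upper_triangular[OF _ rdiag_carrier[of ls]] by simp
qed

lemma char_poly_unitary_conj:
  assumes "unitary n U" "A \<in> carrier_mat n n"
  shows "char_poly (U * A * adj U) = char_poly A"
proof (rule char_poly_similar)
  note U = unitaryD[OF assms(1)]
  show "similar_mat (U * A * adj U) A"
    unfolding similar_mat_def
    by (intro exI[of _ U] exI[of _ "adj U"] similar_mat_witI[of _ _ n]) (use U assms in simp_all)
qed

lemma eigs_unitary_rdiag: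
  assumes "unitary n U" "length ls = n"
  shows "eigs (U * rdiag ls * adj U) = rev (sort ls)"
proof (rule eigs_eqI)
  show "sorted_wrt (\<ge>) (rev (sort ls))" by (simp add: sorted_wrt_rev)
  have "char_poly (U * rdiag ls * adj U) = (\<Prod>l\<leftarrow>ls. [:- complex_of_real l, 1:])"
    using char_poly_unitary_conj[OF assms(1), of "rdiag ls"] rdiag_carrier[of ls] assms(2)
    by (simp add: char_poly_rdiag)
  also have "\<dots> = (\<Prod>l\<leftarrow>rev (sort ls). [:- complex_of_real l, 1:])"
    by (rule prod_list_map_mset_cong) simp
  finally show "char_poly (U * rdiag ls * adj U) = (\<Prod>l\<leftarrow>rev (sort ls). [:- complex_of_real l, 1:])" .
qed

lemma hermitian_eigs:
  assumes A: "A \<in> carrier_mat n n" "adj A = A"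
  shows "length (eigs A) = n" "sorted_wrt (\<ge>) (eigs A)"
    "char_poly A = (\<Prod>l\<leftarrow>eigs A. [:- complex_of_real l, 1:])"
    "\<exists>U. unitary n U \<and> A = U * rdiag (eigs A) * adj U"
proof -
  obtain U as where U: "unitary n U" and as: "length as = n" "A = U * rdiag as * adj U"
    \<comment> \<open>The spectral theorem is the case in which the matrix is paired with
      itself.\<close>
    using simultaneous_diagonalization[OF A A] by blast
  have e: "eigs A = rev (sort as)" using eigs_unitary_rdiag[OF U as(1)] as(2) by simp
  show "length (eigs A) = n" using e as(1) by simp
  show s: "sorted_wrt (\<ge>) (eigs A)" by (simp add: e sorted_wrt_rev)
  have "char_poly A = (\<Prod>l\<leftarrow>as. [:- complex_of_real l, 1:])"
    using char_poly_unitary_conj[OF U, of "rdiag as"] rdiag_carrier[of as] as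
    by (simp add: char_poly_rdiag)
  also have "\<dots> = (\<Prod>l\<leftarrow>eigs A. [:- complex_of_real l, 1:])"
    by (rule prod_list_map_mset_cong) (simp add: e)
  finally show cp: "char_poly A = (\<Prod>l\<leftarrow>eigs A. [:- complex_of_real l, 1:])" .
  show "\<exists>U. unitary n U \<and> A = U * rdiag (eigs A) * adj U"
    using spectral_theorem_ordered[OF A cp] by blast
qed

text \<open>Valid for singular factors too: the block matrices \<open>M\<close> and \<open>N\<close>
  are similar through the block unipotent \<open>P\<close>, since both \<open>M * P\<close> and
  \<open>P * N\<close> have rows (AB, ABA) and (B, BA). The common factor coming from the zero block
  is then cancelled.\<close>

lemma char_poly_mult_comm:
  fixes A B :: "complex mat"
  assumes A: "A \<in> carrier_mat n n" and B: "B \<in> carrier_mat n n"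
  shows "char_poly (A * B) = char_poly (B * A)"
proof -
  define P where "P = four_block_mat (1\<^sub>m n) A (0\<^sub>m n n) (1\<^sub>m n)"
  define Q where "Q = four_block_mat (1\<^sub>m n) (- A) (0\<^sub>m n n) (1\<^sub>m n)"
  define M where "M = four_block_mat (A * B) (0\<^sub>m n n) B (0\<^sub>m n n)"
  define N where "N = four_block_mat (0\<^sub>m n n) (0\<^sub>m n n) B (B * A)"
  note mb = mult_four_block_mat[of _ n n _ n _ n _ _ n _ n]
  have c: "P \<in> carrier_mat (n + n) (n + n)" "Q \<in> carrier_mat (n + n) (n + n)"
    "M \<in> carrier_mat (n + n) (n + n)" "N \<in> carrier_mat (n + n) (n + n)"
    using A B by (auto simp: P_def Q_def M_def N_def)
  have mA: "- A \<in> carrier_mat n n" using A by simp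
  have [simp]: "- 0\<^sub>m n n = (0\<^sub>m n n :: complex mat)" by (rule eq_matI) auto
  have PQ: "P * Q = 1\<^sub>m (n + n)"
    unfolding P_def Q_def using A mA by (subst mb) (auto simp: uminus_l_inv_mat[OF A])
  have QP: "Q * P = 1\<^sub>m (n + n)"
    by (rule mat_mult_left_right_inverse[OF c(1,2) PQ])
  have "M * P = P * N"
    unfolding M_def N_def P_def using A B
    by (simp add: mb assoc_mult_mat[of _ n n _ n _ n])
  then have "P * N * Q = M * (P * Q)" using c by (simp add: assoc_mult_mat[of _ "n+n" "n+n" _ "n+n" _ "n+n"] flip: \<open>M * P = P * N\<close>)
  then have "M = P * N * Q" using c PQ by simp
  then have "similar_mat M N"
    unfolding similar_mat_def
    by (intro exI[of _ P] exI[of _ Q] similar_mat_witI[of _ _ "n + n"]) (use c PQ QP in simp_all)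
  then have "char_poly M = char_poly N" by (rule char_poly_similar)
  have lin: "\<exists>es. char_poly X = (\<Prod>a\<leftarrow>es. [:- a, 1:])" if "X \<in> carrier_mat n n" for X :: "complex mat"
    using char_poly_factorized[OF that] by blast
  have "char_poly M = char_poly (A * B) * char_poly (0\<^sub>m n n)"
    using A B by (intro char_poly_0_block'[OF M_def lin lin]) auto
  moreover have "char_poly N = char_poly (0\<^sub>m n n) * char_poly (B * A)"
    using A B by (intro char_poly_0_block'[OF N_def lin lin]) auto
  moreover have "char_poly (0\<^sub>m n n :: complex mat) \<noteq> 0"
    using degree_monic_char_poly[of "0\<^sub>m n n :: complex mat" n] by auto
  ultimately show ?thesis using \<open>char_poly M = char_poly N\<close> by simp
qed

subsection \<open>Products of the largest singular values\<close>

lemma assoc_mult_mat_dim: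
  fixes A B C :: "'a::semiring_0 mat"
  assumes "dim_col A = dim_row B" "dim_col B = dim_row C"
  shows "A * B * C = A * (B * C)"
  by (rule assoc_mult_mat[of A "dim_row A" "dim_row B" B "dim_row C" C "dim_col C"]) (use assms in auto)

lemma adj_mult_self_mult:
  assumes Y: "Y \<in> carrier_mat m n" and R: "R \<in> carrier_mat n k"
  shows "adj (Y * R) * (Y * R) = adj R * (adj Y * Y) * R"
  using carrier_matD[OF Y] carrier_matD[OF R] by (simp add: adj_mult[OF Y R] assoc_mult_mat_dim)

text \<open>The Gram determinant, the squared volume spanned by the columns of \<open>Y\<close>. It
  is real and nonnegative in any case; the modulus just makes it a real number by type.\<close>

definition gram :: "complex mat \<Rightarrow> real" where
  "gram Y = cmod (det (adj Y * Y))"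

lemma gram_nonneg: "0 \<le> gram Y"
  by (simp add: gram_def)

lemma gram_mult_right:
  assumes Y: "Y \<in> carrier_mat m k" and R: "R \<in> carrier_mat k k"
  shows "gram (Y * R) = (cmod (det R))\<^sup>2 * gram Y"
proof -
  have "adj (Y * R) * (Y * R) = adj R * (adj Y * Y) * R"
    by (rule adj_mult_self_mult[OF Y R])
  moreover have "adj Y * Y \<in> carrier_mat k k" using Y by auto
  ultimately show ?thesis
    using R by (simp add: gram_def det_mult[of _ k] det_adj norm_mult power2_eq_square)
qed

lemma gram_unitary_right:
  assumes "Y \<in> carrier_mat m k" "unitary k Q"
  shows "gram (Y * Q) = gram Y"
proof -
  note Q = unitaryD[OF assms(2)]
  have "cnj (det Q) * det Q = 1"
    using arg_cong[OF Q(4), of det] det_mult[OF Q(2,1)] det_adj[OF Q(1)] by simp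
  then have "(cmod (det Q))\<^sup>2 = 1"
    by (metis mult.commute mult_cnj_cmod of_real_eq_1_iff)
  then show ?thesis using gram_mult_right[OF assms(1) Q(1)] by simp
qed

lemma rdiag_mult:
  assumes "length a = k" "length b = k"
  shows "rdiag a * rdiag b = rdiag (map2 (*) a b)"
proof (rule eq_matI)
  fix i j assume "i < dim_row (rdiag (map2 (*) a b))" "j < dim_col (rdiag (map2 (*) a b))"
  then have ij: "i < k" "j < k" using assms by auto
  have "(rdiag a * rdiag b) $$ (i, j) = (\<Sum>l<k. rdiag a $$ (i, l) * rdiag b $$ (l, j))"
    using ij assms by (subst index_mult_sum[of _ k k _ k]) (auto simp: rdiag_def)
  also have "\<dots> = (\<Sum>l<k. if l = i then rdiag (map2 (*) a b) $$ (i, j) else 0)"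
    using ij assms by (intro sum.cong) auto
  finally have "(rdiag a * rdiag b) $$ (i, j) = (\<Sum>l<k. if l = i then rdiag (map2 (*) a b) $$ (i, j) else 0)" .
  then show "(rdiag a * rdiag b) $$ (i, j) = rdiag (map2 (*) a b) $$ (i, j)" using ij by simp
qed (use assms in auto)

lemma index_adj_rdiag_mult:
  assumes "Y \<in> carrier_mat n k" "length d = n" "i < k"
  shows "(adj Y * rdiag d * Y) $$ (i, i) = complex_of_real (\<Sum>r<n. d ! r * (cmod (Y $$ (r, i)))\<^sup>2)"
proof -
  have d: "rdiag d \<in> carrier_mat n n" using rdiag_carrier[of d] assms by simp
  have dY: "rdiag d * Y \<in> carrier_mat n k" using d assms by auto
  have e: "(rdiag d * Y) $$ (r, i) = complex_of_real (d ! r) * Y $$ (r, i)" if "r < n" for r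
  proof -
    have "(rdiag d * Y) $$ (r, i) = (\<Sum>l<n. rdiag d $$ (r, l) * Y $$ (l, i))"
      using assms that by (subst index_mult_sum[OF d assms(1)]) auto
    also have "\<dots> = (\<Sum>l<n. if l = r then complex_of_real (d ! r) * Y $$ (r, i) else 0)"
      using assms that by (intro sum.cong) auto
    finally have "(rdiag d * Y) $$ (r, i) = (\<Sum>l<n. if l = r then complex_of_real (d ! r) * Y $$ (r, i) else 0)" .
    then show ?thesis using that by simp
  qed
  have "adj Y * rdiag d * Y = adj Y * (rdiag d * Y)"
    using d assms by (intro assoc_mult_mat[of _ k n _ n _ k]) auto
  also have "\<dots> $$ (i, i) = (\<Sum>r<n. cnj (Y $$ (r, i)) * (complex_of_real (d ! r) * Y $$ (r, i)))"
    using assms e by (subst index_mult_sum[OF adj_carrier[OF assms(1)] dY]) auto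
  also have "\<dots> = complex_of_real (\<Sum>r<n. d ! r * (cmod (Y $$ (r, i)))\<^sup>2)"
    unfolding of_real_sum of_real_mult mult_cnj_cmod[symmetric] by (simp add: ac_simps)
  finally show ?thesis .
qed

lemma index_adj_mult_self:
  assumes "Y \<in> carrier_mat n k" "i < k"
  shows "(adj Y * Y) $$ (i, i) = complex_of_real (\<Sum>r<n. (cmod (Y $$ (r, i)))\<^sup>2)"
  unfolding of_real_sum mult_cnj_cmod[symmetric]
  using assms by (subst index_mult_sum[OF adj_carrier[OF assms(1)] assms(1)]) (auto simp: mult.commute)

lemma adj_mult_self_hermitian:
  assumes "Y \<in> carrier_mat n k"
  shows "adj Y * Y \<in> carrier_mat k k" "adj (adj Y * Y) = adj Y * Y"
  using assms by (auto simp: adj_mult[of _ k n _ k])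

text \<open>The entry \<open>d ! i\<close> is the squared norm of column i of
  \<open>Y * U\<close>.\<close>

lemma unitary_conj_diag_nonneg:
  assumes "unitary k U" "length d = k" "Y \<in> carrier_mat n k" "adj Y * Y = U * rdiag d * adj U" "i < k"
  shows "0 \<le> d ! i"
proof -
  note U = unitaryD[OF assms(1)]
  have c: "rdiag d \<in> carrier_mat k k" using rdiag_carrier[of d] assms by simp
  have "adj (Y * U) * (Y * U) = adj U * (adj Y * Y) * U"
    by (rule adj_mult_self_mult[OF assms(3) U(1)])
  also have "\<dots> = rdiag d"
    using iffD2[OF unitary_conj_swap[OF assms(1) adj_mult_self_hermitian(1)[OF assms(3)] c] assms(4)] .
  finally have "(adj (Y * U) * (Y * U)) $$ (i, i) = complex_of_real (d ! i)"
    using assms by simp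
  moreover have YU: "Y * U \<in> carrier_mat n k" using assms U by auto
  ultimately have "d ! i = (\<Sum>r<n. (cmod ((Y * U) $$ (r, i)))\<^sup>2)"
    using index_adj_mult_self[OF YU assms(5)] by (metis of_real_eq_iff)
  then show ?thesis by (simp add: sum_nonneg)
qed

lemma eigs_adj_mult_self_nonneg:
  assumes "Y \<in> carrier_mat n k" "x \<in> set (eigs (adj Y * Y))"
  shows "0 \<le> x"
proof -
  note h = hermitian_eigs[OF adj_mult_self_hermitian[OF assms(1)]]
  obtain U where "unitary k U" "adj Y * Y = U * rdiag (eigs (adj Y * Y)) * adj U" using h(4) by blast
  then show ?thesis
    using unitary_conj_diag_nonneg[OF _ h(1) assms(1)] assms(2) h(1) by (metis in_set_conv_nth)
qed

lemma prod_list_take_nth: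
  fixes d :: "'a::comm_monoid_mult list"
  assumes "k \<le> length d"
  shows "prod_list (take k d) = (\<Prod>i<k. d ! i)"
  using assms by (induction k) (auto simp: take_Suc_conv_app_nth mult.commute)

lemma det_zero_row:
  fixes C :: "complex mat"
  assumes "C \<in> carrier_mat n n" "i < n" "\<And>j. j < n \<Longrightarrow> C $$ (i, j) = 0"
  shows "det C = 0"
proof -
  \<comment> \<open>Scaling a zero row by 0 changes nothing, yet multiplies the determinant by
    0.\<close>
  have "C = multrow i 0 C" using assms by (intro eq_matI) auto
  then show ?thesis using det_multrow[OF assms(2,1), of 0] by simp
qed

text \<open>Half of the Courant--Fischer principle: among the first \<open>i + 1\<close> columns of an isometry
  there is a combination orthogonal to the first \<open>i\<close> unit vectors.\<close>

lemma isometry_compression_le: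
  assumes Y: "Y \<in> carrier_mat m k" "adj Y * Y = 1\<^sub>m k"
    and d: "length d = m" "sorted_wrt (\<ge>) d"
    and \<mu>: "length \<mu> = k" "sorted_wrt (\<ge>) \<mu>" and eq: "adj Y * rdiag d * Y = rdiag \<mu>"
    and i: "i < k" "i < m"
  shows "\<mu> ! i \<le> d ! i"
proof -
  have cd: "rdiag d \<in> carrier_mat m m" using rdiag_carrier[of d] d by simp
  have one: "0 < (1::nat)" by simp
  \<comment> \<open>The i orthogonality conditions on i + 1 coefficients, padded by a zero row to a
    square matrix. Its determinant vanishes, which yields a nonzero solution
    \<open>c\<close>.\<close>
  define C where "C = mat (Suc i) (Suc i) (\<lambda>(r, j). if r < i then Y $$ (r, j) else 0)"
  have C: "C \<in> carrier_mat (Suc i) (Suc i)" by (simp add: C_def)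
  have "det C = 0" by (rule det_zero_row[OF C, of i]) (auto simp: C_def)
  then obtain c where c: "c \<in> carrier_vec (Suc i)" "c \<noteq> 0\<^sub>v (Suc i)" "C *\<^sub>v c = 0\<^sub>v (Suc i)"
    using det_0_iff_vec_prod_zero[OF C] by blast
  define x where "x = mat k 1 (\<lambda>(j, _). if j \<le> i then c $ j else 0)"
  have x: "x \<in> carrier_mat k 1" by (simp add: x_def)
  define y where "y = Y * x"
  have y: "y \<in> carrier_mat m 1" using Y x by (auto simp: y_def)
  have y0: "y $$ (r, 0) = 0" if r: "r < i" for r
  proof -
    have "y $$ (r, 0) = (\<Sum>j<k. Y $$ (r, j) * x $$ (j, 0))"
      unfolding y_def using r i by (subst index_mult_sum[OF Y(1) x]) auto
    also have "\<dots> = (\<Sum>j<Suc i. Y $$ (r, j) * c $ j)"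
      by (rule sum.mono_neutral_cong_right) (use i in \<open>auto simp: x_def\<close>)
    also have "\<dots> = (C *\<^sub>v c) $ r"
      using r c(1) C by (auto simp: C_def scalar_prod_def lessThan_atLeast0 intro!: sum.cong)
    finally show ?thesis using c(3) r by simp
  qed
  have "adj y * y = adj x * (adj Y * Y) * x"
    unfolding y_def by (rule adj_mult_self_mult[OF Y(1) x])
  also have "\<dots> = adj x * x" using x by (simp add: Y(2))
  finally have "adj y * y = adj x * x" .
  from arg_cong[OF this, of "\<lambda>A. A $$ (0, 0)"]
  have norm_eq: "(\<Sum>r<m. (cmod (y $$ (r, 0)))\<^sup>2) = (\<Sum>j<k. (cmod (x $$ (j, 0)))\<^sup>2)"
    unfolding index_adj_mult_self[OF y one] index_adj_mult_self[OF x one] of_real_eq_iff .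
  have "adj y * rdiag d * y = adj x * (adj Y * rdiag d * Y) * x"
    unfolding y_def using carrier_matD[OF Y(1)] carrier_matD[OF x] d(1)
    by (simp add: adj_mult[OF Y(1) x] assoc_mult_mat_dim)
  from arg_cong[OF this, of "\<lambda>A. A $$ (0, 0)"]
  have quad: "(\<Sum>r<m. d ! r * (cmod (y $$ (r, 0)))\<^sup>2) = (\<Sum>j<k. \<mu> ! j * (cmod (x $$ (j, 0)))\<^sup>2)"
    unfolding eq index_adj_rdiag_mult[OF y d(1) one]
      index_adj_rdiag_mult[OF x \<mu>(1) one] of_real_eq_iff .
  define S where "S = (\<Sum>j<k. (cmod (x $$ (j, 0)))\<^sup>2)"
  have "\<exists>j\<le>i. c $ j \<noteq> 0"
  proof (rule ccontr)
    assume "\<not> (\<exists>j\<le>i. c $ j \<noteq> 0)"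
    then have "c = 0\<^sub>v (Suc i)" using c(1) by (intro eq_vecI) auto
    then show False using c(2) by simp
  qed
  then obtain j where "j \<le> i" "c $ j \<noteq> 0" by blast
  then have "j < k" "x $$ (j, 0) \<noteq> 0" using i by (auto simp: x_def)
  then have S: "0 < S" unfolding S_def by (intro sum_pos2[of _ j]) auto
  \<comment> \<open>One quadratic form bounded twice: \<open>x\<close> lives on indices up to i,
    where \<mu> is at least \<open>\<mu> ! i\<close>; its image \<open>y\<close> lives on indices
    from i on, where \<open>d\<close> is at most \<open>d ! i\<close>. The isometry makes the norms
    of \<open>x\<close> and \<open>y\<close> equal.\<close>
  have "\<mu> ! i * S = (\<Sum>j<k. \<mu> ! i * (cmod (x $$ (j, 0)))\<^sup>2)"
    by (simp add: S_def sum_distrib_left)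
  also have "\<dots> \<le> (\<Sum>j<k. \<mu> ! j * (cmod (x $$ (j, 0)))\<^sup>2)"
  proof (rule sum_mono)
    fix j assume "j \<in> {..<k}"
    moreover have "\<mu> ! i \<le> \<mu> ! j" if "j \<le> i"
      using \<mu> i that sorted_wrt_iff_nth_less[of "(\<ge>)" \<mu>] by (cases "j = i") auto
    ultimately show "\<mu> ! i * (cmod (x $$ (j, 0)))\<^sup>2 \<le> \<mu> ! j * (cmod (x $$ (j, 0)))\<^sup>2"
      by (cases "j \<le> i") (auto simp: x_def intro: mult_right_mono)
  qed
  also have "\<dots> = (\<Sum>r<m. d ! r * (cmod (y $$ (r, 0)))\<^sup>2)" by (simp add: quad)
  also have "\<dots> \<le> (\<Sum>r<m. d ! i * (cmod (y $$ (r, 0)))\<^sup>2)"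
  proof (rule sum_mono)
    fix r assume "r \<in> {..<m}"
    moreover have "d ! r \<le> d ! i" if "i \<le> r" "r < m"
      using d i that sorted_wrt_iff_nth_less[of "(\<ge>)" d] by (cases "r = i") auto
    ultimately show "d ! r * (cmod (y $$ (r, 0)))\<^sup>2 \<le> d ! i * (cmod (y $$ (r, 0)))\<^sup>2"
      using y0 by (cases "i \<le> r") (auto intro: mult_right_mono)
  qed
  also have "\<dots> = d ! i * S" by (simp add: sum_distrib_left[symmetric] norm_eq S_def)
  finally show ?thesis using S by simp
qed

text \<open>For k up to the size of \<open>M\<close> this is the squared operator norm of the k-th
  exterior power of \<open>M\<close>. Working with squares avoids roots until the very end.\<close>

definition top_prod :: "nat \<Rightarrow> complex mat \<Rightarrow> real" where
  "top_prod k M = prod_list (take k (eigs (adj M * M)))"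

lemma top_prod_nonneg:
  assumes "M \<in> carrier_mat m m"
  shows "0 \<le> top_prod k M"
  unfolding top_prod_def
  by (intro prod_list_nonneg) (meson assms eigs_adj_mult_self_nonneg in_set_takeD)

text \<open>The Gram matrix of \<open>M * X\<close> is a compression of \<open>adj M * M\<close>, so
  its eigenvalues are dominated one by one by the k largest of the latter. Their product is the
  determinant.\<close>

lemma gram_isometry_le:
  assumes M: "M \<in> carrier_mat m m" and X: "X \<in> carrier_mat m k" "adj X * X = 1\<^sub>m k" and k: "k \<le> m"
  shows "gram (M * X) \<le> top_prod k M"
proof -
  define d where "d = eigs (adj M * M)"
  note h = hermitian_eigs[OF adj_mult_self_hermitian[OF M], folded d_def]
  obtain U where U: "unitary m U" and MU: "adj M * M = U * rdiag d * adj U" using h(4) by blast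
  note UU = unitaryD[OF U]
  have cd: "rdiag d \<in> carrier_mat m m" using rdiag_carrier[of d] h(1) by simp
  have MX: "M * X \<in> carrier_mat m k" using M X by auto
  define \<mu> where "\<mu> = eigs (adj (M * X) * (M * X))"
  note g = hermitian_eigs[OF adj_mult_self_hermitian[OF MX], folded \<mu>_def]
  obtain Q where Q: "unitary k Q" and GQ: "adj (M * X) * (M * X) = Q * rdiag \<mu> * adj Q" using g(4) by blast
  note QQ = unitaryD[OF Q]
  have c\<mu>: "rdiag \<mu> \<in> carrier_mat k k" using rdiag_carrier[of \<mu>] g(1) by simp
  \<comment> \<open>\<open>X\<close> rewritten in the eigenbases of both Hermitian matrices: still
    an isometry, and it now compresses one diagonal matrix to another.\<close>
  define Y where "Y = adj U * X * Q"
  have Y: "Y \<in> carrier_mat m k" unfolding Y_def using UU QQ X by auto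
  note dims = carrier_matD[OF UU(1)] carrier_matD[OF QQ(1)] carrier_matD[OF X(1)] carrier_matD[OF M] h(1) g(1)
  have adjY: "adj Y = adj Q * (adj X * U)"
    unfolding Y_def
    by (subst adj_mult[of _ m k _ k], use UU QQ X in auto, subst adj_mult[of _ m m _ k], auto)
  have "adj Y * Y = adj Q * (adj X * ((U * adj U) * X)) * Q"
    unfolding adjY unfolding Y_def by (simp add: assoc_mult_mat_dim dims)
  also have "\<dots> = 1\<^sub>m k" using UU QQ X by simp
  finally have YY: "adj Y * Y = 1\<^sub>m k" .
  have "adj Y * rdiag d * Y = adj Q * (adj X * (U * rdiag d * adj U) * X) * Q"
    unfolding adjY unfolding Y_def by (simp add: assoc_mult_mat_dim dims)
  also have "\<dots> = adj Q * (adj (M * X) * (M * X)) * Q"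
    unfolding MU[symmetric] by (simp add: adj_mult[OF M X(1)] assoc_mult_mat_dim dims)
  also have "\<dots> = rdiag \<mu>"
    by (rule iffD2[OF unitary_conj_swap[OF Q adj_mult_self_hermitian(1)[OF MX] c\<mu>] GQ])
  finally have Yd: "adj Y * rdiag d * Y = rdiag \<mu>" .
  have le: "\<mu> ! i \<le> d ! i" if "i < k" for i
    using isometry_compression_le[OF Y YY h(1,2) g(1,2) Yd that] that k by simp
  have nn: "0 \<le> \<mu> ! i" if "i < k" for i
    using eigs_adj_mult_self_nonneg[OF MX, of "\<mu> ! i"] that g(1) by (simp add: \<mu>_def)
  have "gram (M * X) = cmod (cnj (det Q) * det Q * complex_of_real (prod_list \<mu>))"
    unfolding gram_def GQ using QQ c\<mu> by (simp add: det_mult[of _ k] det_adj det_rdiag ac_simps)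
  also have "cnj (det Q) * det Q = 1"
    using arg_cong[OF QQ(4), of det] det_mult[OF QQ(2,1)] det_adj[OF QQ(1)] by simp
  also have "cmod (1 * complex_of_real (prod_list \<mu>)) = prod_list (take k \<mu>)"
    using nn g(1) by (simp add: in_set_conv_nth) (metis abs_of_nonneg prod_list_nonneg in_set_conv_nth)
  also have "\<dots> = (\<Prod>i<k. \<mu> ! i)" using g(1) by (intro prod_list_take_nth) simp
  also have "\<dots> \<le> (\<Prod>i<k. d ! i)" using nn le by (intro prod_mono) auto
  also have "\<dots> = top_prod k M" using h(1) k by (simp add: prod_list_take_nth top_prod_def flip: d_def)
  finally show ?thesis .
qed

section \<open>Leading columns: the maximum is attained, and Weyl's inequality\<close>

definition first_cols :: "nat \<Rightarrow> nat \<Rightarrow> complex mat" where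
  "first_cols m k = mat m k (\<lambda>(i, j). of_bool (i = j))"

lemma first_cols_carrier [simp]: "first_cols m k \<in> carrier_mat m k"
  by (simp add: first_cols_def)

lemma index_mult_first_cols:
  assumes "A \<in> carrier_mat n m" "k \<le> m" "i < n" "j < k"
  shows "(A * first_cols m k) $$ (i, j) = A $$ (i, j)"
proof -
  have "(A * first_cols m k) $$ (i, j) = (\<Sum>l<m. if l = j then A $$ (i, j) else 0)"
    using assms by (subst index_mult_sum[OF assms(1) first_cols_carrier]) (auto simp: first_cols_def intro!: sum.cong)
  then show ?thesis using assms by simp
qed

lemma index_adj_first_cols_mult:
  assumes "A \<in> carrier_mat m n" "k \<le> m" "i < k" "j < n"
  shows "(adj (first_cols m k) * A) $$ (i, j) = A $$ (i, j)"
proof -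
  have "(adj (first_cols m k) * A) $$ (i, j) = (\<Sum>l<m. cnj (of_bool (l = i)) * A $$ (l, j))"
    using assms by (subst index_mult_sum[OF adj_carrier[OF first_cols_carrier] assms(1)])
      (auto simp: first_cols_def intro!: sum.cong)
  also have "\<dots> = (\<Sum>l<m. if l = i then A $$ (i, j) else 0)"
    by (rule sum.cong) auto
  finally have "(adj (first_cols m k) * A) $$ (i, j) = (\<Sum>l<m. if l = i then A $$ (i, j) else 0)" .
  then show ?thesis using assms by simp
qed

lemma first_cols_isometry:
  assumes "k \<le> m"
  shows "adj (first_cols m k) * first_cols m k = 1\<^sub>m k"
  using assms
  by (intro eq_matI) (auto simp: index_adj_first_cols_mult[OF first_cols_carrier] simp del: index_mult_mat(1),
     auto simp: first_cols_def)

lemma unitary_mult_isometry: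
  assumes "unitary m U" "X \<in> carrier_mat m k" "adj X * X = 1\<^sub>m k"
  shows "adj (U * X) * (U * X) = 1\<^sub>m k"
proof -
  note U = unitaryD[OF assms(1)]
  have "adj (U * X) * (U * X) = adj X * (adj U * (U * X))"
    using U(1,2) assms(2) by (simp add: adj_mult[of _ m m _ k] assoc_mult_mat[of _ k m _ m _ k])
  also have "adj U * (U * X) = X"
    using U assms(2) by (subst assoc_mult_mat[of _ m m _ m _ k, symmetric]) auto
  finally show ?thesis using assms by simp
qed

text \<open>The maximizer consists of the first k columns of \<open>U\<close>, eigenvectors of
  \<open>adj M * M\<close> for its k largest eigenvalues.\<close>

lemma gram_isometry_attained:
  assumes M: "M \<in> carrier_mat m m" and k: "k \<le> m"
  shows "\<exists>X. X \<in> carrier_mat m k \<and> adj X * X = 1\<^sub>m k \<and> gram (M * X) = top_prod k M"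
proof -
  define d where "d = eigs (adj M * M)"
  note h = hermitian_eigs[OF adj_mult_self_hermitian[OF M], folded d_def]
  obtain U where U: "unitary m U" and MU: "adj M * M = U * rdiag d * adj U" using h(4) by blast
  note UU = unitaryD[OF U]
  have cd: "rdiag d \<in> carrier_mat m m" using rdiag_carrier[of d] h(1) by simp
  define J where "J = first_cols m k"
  have J: "J \<in> carrier_mat m k" by (simp add: J_def)
  have UJ: "U * J \<in> carrier_mat m k" using UU J by auto
  have "adj (M * (U * J)) * (M * (U * J)) = adj J * (adj U * (adj M * M) * U * J)"
    using carrier_matD[OF M] carrier_matD[OF UU(1)] carrier_matD[OF J]
    by (simp add: adj_mult[OF M UJ] adj_mult[OF UU(1) J] assoc_mult_mat_dim)
  also have "adj U * (adj M * M) * U = rdiag d"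
    by (rule iffD2[OF unitary_conj_swap[OF U adj_mult_self_hermitian(1)[OF M] cd] MU])
  also have "adj J * (rdiag d * J) = rdiag (take k d)"
  proof (rule eq_matI)
    fix i j assume "i < dim_row (rdiag (take k d))" "j < dim_col (rdiag (take k d))"
    then have ij: "i < k" "j < k" using h(1) by auto
    have "(adj J * (rdiag d * J)) $$ (i, j) = rdiag d $$ (i, j)"
      unfolding J_def using ij k cd
      by (subst index_adj_first_cols_mult[of _ m k]) (auto simp: index_mult_first_cols[OF cd k] simp del: index_mult_mat(1))
    then show "(adj J * (rdiag d * J)) $$ (i, j) = rdiag (take k d) $$ (i, j)"
      using ij k h(1) by simp
  qed (use J h(1) k in auto)
  finally have "gram (M * (U * J)) = \<bar>prod_list (take k d)\<bar>"
    by (simp add: gram_def det_rdiag)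
  also have "\<dots> = top_prod k M"
    using top_prod_nonneg[OF M, of k] by (simp add: top_prod_def d_def)
  finally show ?thesis
    using UJ unitary_mult_isometry[OF U J] first_cols_isometry[OF k] by (auto simp: J_def)
qed

text \<open>Weyl's inequality: combined with \<open>gram_isometry_le\<close>, it bounds products of eigenvalues
  by products of singular values.\<close>

lemma gram_isometry_eigenvalues:
  assumes Z: "Z \<in> carrier_mat m m" and k: "k \<le> m"
    and cp: "char_poly Z = (\<Prod>l\<leftarrow>ls. [:- complex_of_real l, 1:])"
  shows "\<exists>X. X \<in> carrier_mat m k \<and> adj X * X = 1\<^sub>m k \<and> gram (Z * X) = (prod_list (take k ls))\<^sup>2"
proof -
  have "char_poly Z = (\<Prod>e\<leftarrow>map complex_of_real ls. [:- e, 1:])"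
    using cp by (simp add: o_def)
  from unitary_schur[OF Z this] obtain U where U: "unitary m U"
    and tri: "upper_triangular (adj U * Z * U)"
    and dg: "diag_mat (adj U * Z * U) = map complex_of_real ls" by blast
  note UU = unitaryD[OF U]
  define T where "T = adj U * Z * U"
  have T: "T \<in> carrier_mat m m" using UU Z by (simp add: T_def)
  have len: "length ls = m" using arg_cong[OF dg[folded T_def], of length] T by (simp add: diag_mat_def)
  have d: "T $$ (i, i) = complex_of_real (ls ! i)" if "i < m" for i
    using arg_cong[OF dg[folded T_def], of "\<lambda>l. l ! i"] that T len by (simp add: diag_mat_def)
  have lo: "T $$ (i, j) = 0" if "j < i" "i < m" for i j
    using tri that T by (auto simp: T_def[symmetric] upper_triangular_def)
  define J where "J = first_cols m k"
  have J: "J \<in> carrier_mat m k" by (simp add: J_def)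
  define R where "R = mat k k (\<lambda>(i, j). T $$ (i, j))"
  have R: "R \<in> carrier_mat k k" by (simp add: R_def)
  \<comment> \<open>The first k coordinates span an invariant subspace of an upper triangular
    matrix; \<open>R\<close> is its leading block, and its determinant is the product of the
    prescribed first k eigenvalues.\<close>
  have TJ: "T * J = J * R"
  proof (rule eq_matI)
    fix i j assume "i < dim_row (J * R)" "j < dim_col (J * R)"
    then have ij: "i < m" "j < k" using J R by auto
    have "(J * R) $$ (i, j) = (\<Sum>l<k. if l = i then T $$ (i, j) else 0)"
      using ij k by (subst index_mult_sum[OF J R]) (auto simp: J_def R_def first_cols_def intro!: sum.cong)
    also have "\<dots> = T $$ (i, j)" using ij k lo[of j i] by auto
    also have "\<dots> = (T * J) $$ (i, j)" using ij k by (simp add: J_def index_mult_first_cols[OF T] del: index_mult_mat)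
    finally show "(T * J) $$ (i, j) = (J * R) $$ (i, j)" by simp
  qed (use T J R in auto)
  have ZU: "Z * U = U * T"
  proof -
    have "U * T = (U * adj U) * (Z * U)"
      unfolding T_def using UU(1,2) Z by (simp add: assoc_mult_mat[of _ m m _ m _ m])
    then show ?thesis using UU Z by simp
  qed
  have UJ: "U * J \<in> carrier_mat m k" using UU J by auto
  have iso: "adj (U * J) * (U * J) = 1\<^sub>m k"
    using unitary_mult_isometry[OF U J] first_cols_isometry[OF k] by (simp add: J_def)
  have "Z * (U * J) = (Z * U) * J" using Z UU J by (intro assoc_mult_mat[symmetric]) auto
  also have "\<dots> = U * (T * J)" unfolding ZU using T UU J by (intro assoc_mult_mat) auto
  also have "\<dots> = (U * J) * R" unfolding TJ using UU J R by (intro assoc_mult_mat[symmetric]) auto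
  finally have "gram (Z * (U * J)) = (cmod (det R))\<^sup>2 * gram (U * J)"
    using gram_mult_right[OF UJ R] by simp
  also have "gram (U * J) = 1" by (simp add: gram_def iso)
  also have "det R = complex_of_real (prod_list (take k ls))"
  proof -
    have "upper_triangular R" using lo k by (auto simp: upper_triangular_def R_def)
    then have "det R = prod_list (diag_mat R)" using R by (rule det_upper_triangular)
    also have "diag_mat R = map complex_of_real (take k ls)"
      using d k len by (intro nth_equalityI) (auto simp: diag_mat_def R_def)
    also have "prod_list (map complex_of_real xs) = complex_of_real (prod_list xs)" for xs
      by (induction xs) auto
    finally show ?thesis .
  qed
  finally show ?thesis using UJ iso by (auto simp: norm_of_real)
qed

text \<open>Extends the bound from isometries to arbitrary \<open>Y\<close>. Rotating by the
  eigenbasis of \<open>adj Y * Y\<close> makes the columns orthogonal without changing either Gram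
  determinant; normalizing them reduces to \<open>gram_isometry_le\<close>.\<close>

lemma gram_mult_le:
  assumes M: "M \<in> carrier_mat m m" and Y: "Y \<in> carrier_mat m k" and k: "k \<le> m"
  shows "gram (M * Y) \<le> top_prod k M * gram Y"
proof -
  define \<mu> where "\<mu> = eigs (adj Y * Y)"
  note g = hermitian_eigs[OF adj_mult_self_hermitian[OF Y], folded \<mu>_def]
  obtain Q where Q: "unitary k Q" and GQ: "adj Y * Y = Q * rdiag \<mu> * adj Q" using g(4) by blast
  note QQ = unitaryD[OF Q]
  have c\<mu>: "rdiag \<mu> \<in> carrier_mat k k" using rdiag_carrier[of \<mu>] g(1) by simp
  define W where "W = Y * Q"
  have W: "W \<in> carrier_mat m k" using Y QQ by (auto simp: W_def)
  have "adj W * W = adj Q * (adj Y * Y) * Q"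
    unfolding W_def by (rule adj_mult_self_mult[OF Y QQ(1)])
  also have "\<dots> = rdiag \<mu>"
    by (rule iffD2[OF unitary_conj_swap[OF Q adj_mult_self_hermitian(1)[OF Y] c\<mu>] GQ])
  finally have WW: "adj W * W = rdiag \<mu>" .
  have MW: "gram (M * Y) = gram (M * W)"
  proof -
    have "M * W = M * Y * Q" unfolding W_def using M Y QQ by (intro assoc_mult_mat[symmetric]) auto
    moreover have "M * Y \<in> carrier_mat m k" using M Y by auto
    ultimately show ?thesis using gram_unitary_right[OF _ Q] by simp
  qed
  have gW: "gram Y = gram W" using gram_unitary_right[OF Y Q] by (simp add: W_def)
  have cMW: "M * W \<in> carrier_mat m k" using M W by auto
  show ?thesis
  proof (cases "\<exists>i<k. \<mu> ! i = 0")
    case True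
    \<comment> \<open>A zero eigenvalue is a zero column of \<open>W\<close>, hence of
      \<open>M * W\<close>, and the left-hand side vanishes.\<close>
    then obtain i where i: "i < k" "\<mu> ! i = 0" by blast
    have "complex_of_real (\<Sum>r<m. (cmod (W $$ (r, i)))\<^sup>2) = 0"
      using index_adj_mult_self[OF W i(1)] i g(1) by (simp add: WW)
    then have "(\<Sum>r<m. (cmod (W $$ (r, i)))\<^sup>2) = 0" by (simp only: of_real_eq_0_iff)
    then have W0: "W $$ (r, i) = 0" if "r < m" for r
      using that by (subst (asm) sum_nonneg_eq_0_iff) auto
    have MW0: "(M * W) $$ (r, i) = 0" if "r < m" for r
      using that i W0 by (subst index_mult_sum[OF M W]) auto
    define G where "G = adj (M * W) * (M * W)"
    have G: "G \<in> carrier_mat k k" "adj G = G"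
      using adj_mult_self_hermitian[OF cMW] by (auto simp: G_def)
    have Gi: "G $$ (j, i) = 0" if "j < k" for j
      unfolding G_def using that i MW0
      by (subst index_mult_sum[OF adj_carrier[OF cMW] cMW]) auto
    have "G $$ (i, j) = 0" if "j < k" for j
      using index_adj[of i G j] G i that Gi[OF that] by simp
    then have "det G = 0" using det_zero_row[OF G(1) i(1)] by blast
    then show ?thesis
      using top_prod_nonneg[OF M, of k] gram_nonneg[of Y] by (simp add: MW) (simp add: gram_def G_def)
  next
    case False
    have pos: "0 < \<mu> ! i" if "i < k" for i
      using eigs_adj_mult_self_nonneg[OF Y, of "\<mu> ! i"] that g(1) False by (force simp: \<mu>_def)
    \<comment> \<open>\<open>R\<close> carries the column lengths of \<open>W\<close> and
      \<open>R'\<close> is its inverse, so \<open>W\<close> factors as an isometry \<open>S\<close>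
      times \<open>R\<close>.\<close>
    define R where "R = rdiag (map sqrt \<mu>)"
    define R' where "R' = rdiag (map (\<lambda>x. 1 / sqrt x) \<mu>)"
    have R: "R \<in> carrier_mat k k" "R' \<in> carrier_mat k k"
      using rdiag_carrier[of "map sqrt \<mu>"] rdiag_carrier[of "map (\<lambda>x. 1 / sqrt x) \<mu>"] g(1)
      by (auto simp: R_def R'_def)
    have R'R: "R' * R = 1\<^sub>m k"
    proof -
      have "R' * R = rdiag (map2 (*) (map (\<lambda>x. 1 / sqrt x) \<mu>) (map sqrt \<mu>))"
        unfolding R_def R'_def using g(1) by (intro rdiag_mult) auto
      also have "map2 (*) (map (\<lambda>x. 1 / sqrt x) \<mu>) (map sqrt \<mu>) = replicate k 1"
        using pos g(1) by (intro nth_equalityI) (auto simp: less_imp_neq[symmetric])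
      also have "rdiag (replicate k 1) = 1\<^sub>m k" by (rule eq_matI) auto
      finally show ?thesis .
    qed
    have "R' * rdiag \<mu> * R' = rdiag (map2 (*) (map2 (*) (map (\<lambda>x. 1 / sqrt x) \<mu>) \<mu>) (map (\<lambda>x. 1 / sqrt x) \<mu>))"
      unfolding R'_def using g(1) by (subst rdiag_mult, simp, simp, subst rdiag_mult) auto
    also have "map2 (*) (map2 (*) (map (\<lambda>x. 1 / sqrt x) \<mu>) \<mu>) (map (\<lambda>x. 1 / sqrt x) \<mu>) = replicate k 1"
      using pos g(1) by (intro nth_equalityI) (auto simp: less_imp_neq[symmetric] abs_of_pos)
    also have "rdiag (replicate k 1) = 1\<^sub>m k" by (rule eq_matI) auto
    finally have R'\<mu>R': "R' * rdiag \<mu> * R' = 1\<^sub>m k" .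
    define S where "S = W * R'"
    have S: "S \<in> carrier_mat m k" using W R by (auto simp: S_def)
    have "adj S * S = R' * (adj W * W) * R'"
      using adj_mult_self_mult[OF W R(2)] by (simp add: S_def) (simp add: R'_def)
    then have SS: "adj S * S = 1\<^sub>m k" by (simp add: WW R'\<mu>R')
    have "S * R = W * (R' * R)" unfolding S_def using W R by (intro assoc_mult_mat) auto
    then have WS: "W = S * R" using R'R W by simp
    have "M * W = M * S * R" unfolding WS using M S R by (intro assoc_mult_mat[symmetric]) auto
    moreover have "M * S \<in> carrier_mat m k" using M S by auto
    ultimately have "gram (M * W) = (cmod (det R))\<^sup>2 * gram (M * S)"
      using gram_mult_right[OF _ R(1)] by simp
    also have "\<dots> \<le> (cmod (det R))\<^sup>2 * top_prod k M"
      using gram_isometry_le[OF M S SS k] by (intro mult_left_mono) auto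
    also have "(cmod (det R))\<^sup>2 = gram W"
      using gram_mult_right[OF S R(1)] by (simp add: WS[symmetric]) (simp add: gram_def SS)
    finally show ?thesis by (simp add: MW gW mult.commute)
  qed
qed

text \<open>Horn's inequality: take a maximizing isometry for the product, then peel off
  \<open>M\<close> with \<open>gram_mult_le\<close>.\<close>

lemma top_prod_mult_le:
  assumes M: "M \<in> carrier_mat m m" and N: "N \<in> carrier_mat m m" and k: "k \<le> m"
  shows "top_prod k (M * N) \<le> top_prod k M * top_prod k N"
proof -
  have "M * N \<in> carrier_mat m m" using M N by simp
  then obtain X where X: "X \<in> carrier_mat m k" "adj X * X = 1\<^sub>m k" "gram (M * N * X) = top_prod k (M * N)"
    using gram_isometry_attained k by blast
  have "top_prod k (M * N) = gram (M * (N * X))" using X M N by (simp add: assoc_mult_mat[of _ m m _ m _ k])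
  also have "\<dots> \<le> top_prod k M * gram (N * X)" using M N X k by (intro gram_mult_le) auto
  also have "\<dots> \<le> top_prod k M * top_prod k N"
    using gram_isometry_le[OF N X(1,2) k] top_prod_nonneg[OF M] by (intro mult_left_mono)
  finally show ?thesis .
qed

lemma top_prod_adj:
  assumes "M \<in> carrier_mat m m"
  shows "top_prod k (adj M) = top_prod k M"
  unfolding top_prod_def adj_adj
  using eigs_cong[OF char_poly_mult_comm[OF assms adj_carrier[OF assms]]] by simp

text \<open>Weyl's inequality in squared form, for real eigenvalues listed in any order.\<close>

lemma prod_eigenvalues_le:
  assumes Z: "Z \<in> carrier_mat m m" and k: "k \<le> m"
    and cp: "char_poly Z = (\<Prod>l\<leftarrow>ls. [:- complex_of_real l, 1:])"
  shows "(prod_list (take k ls))\<^sup>2 \<le> top_prod k Z"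
  using gram_isometry_eigenvalues[OF assms] gram_isometry_le[OF Z _ _ k] by metis

subsection \<open>Log-convexity along the path of diagonal factors\<close>

text \<open>The matrix K of the overview, with the two diagonals as parameters instead of the
  exponent.\<close>

definition sandwich :: "complex mat \<Rightarrow> real list \<Rightarrow> real list \<Rightarrow> complex mat" where
  "sandwich W d e = rdiag d * W * rdiag e"

lemma sandwich_carrier:
  assumes "W \<in> carrier_mat m m" "length d = m" "length e = m"
  shows "sandwich W d e \<in> carrier_mat m m"
  using assms rdiag_carrier[of d] rdiag_carrier[of e] by (simp add: sandwich_def)

lemma index_sandwich:
  assumes "W \<in> carrier_mat m m" "length d = m" "length e = m" "i < m" "j < m"
  shows "sandwich W d e $$ (i, j) = complex_of_real (d ! i) * W $$ (i, j) * complex_of_real (e ! j)"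
proof -
  have d: "rdiag d \<in> carrier_mat m m" and e: "rdiag e \<in> carrier_mat m m"
    using assms rdiag_carrier by metis+
  have dW: "(rdiag d * W) $$ (i, j) = complex_of_real (d ! i) * W $$ (i, j)" if "j < m" for j
  proof -
    have "(rdiag d * W) $$ (i, j) = (\<Sum>l<m. rdiag d $$ (i, l) * W $$ (l, j))"
      using assms that by (subst index_mult_sum[OF d assms(1)]) auto
    also have "\<dots> = (\<Sum>l<m. if l = i then complex_of_real (d ! i) * W $$ (i, j) else 0)"
      using assms by (intro sum.cong) auto
    finally show ?thesis using assms by simp
  qed
  have "sandwich W d e $$ (i, j) = (\<Sum>l<m. (rdiag d * W) $$ (i, l) * rdiag e $$ (l, j))"
    unfolding sandwich_def using assms d by (subst index_mult_sum[of _ m m _ m]) (auto simp del: index_mult_mat(1))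
  also have "\<dots> = (\<Sum>l<m. if l = j then complex_of_real (d ! i) * W $$ (i, j) * complex_of_real (e ! j) else 0)"
    using assms by (intro sum.cong) (auto simp: dW simp del: index_mult_mat(1))
  finally show ?thesis using assms by simp
qed

lemma adj_sandwich:
  assumes "W \<in> carrier_mat m m" "length d = m" "length e = m"
  shows "adj (sandwich W d e) = rdiag e * adj W * rdiag d"
proof -
  have d: "rdiag d \<in> carrier_mat m m" and e: "rdiag e \<in> carrier_mat m m"
    using assms rdiag_carrier by metis+
  then show ?thesis
    using assms by (simp add: sandwich_def adj_mult[of _ m m _ m] assoc_mult_mat_dim)
qed

text \<open>Cyclic permutation turns E Y E, with Y =
  \<open>adj W * (rdiag ds * rdiag dt) * W\<close>, into Y E^2. Splitting E^2 and permuting again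
  gives \<open>adj Ks * Kt\<close>. Its eigenvalues are those of \<open>adj K * K\<close>, so Weyl
  bounds their squared product and Horn separates the two factors.\<close>

lemma top_prod_sandwich_midpoint:
  assumes W: "W \<in> carrier_mat m m" and k: "k \<le> m"
    and len: "length d = m" "length e = m" "length ds = m" "length es = m" "length dt = m" "length et = m"
    and d: "\<And>i. i < m \<Longrightarrow> (d ! i)\<^sup>2 = ds ! i * dt ! i"
    and e: "\<And>i. i < m \<Longrightarrow> (e ! i)\<^sup>2 = es ! i * et ! i"
  shows "(top_prod k (sandwich W d e))\<^sup>2 \<le> top_prod k (sandwich W ds es) * top_prod k (sandwich W dt et)"
proof -
  have c: "rdiag x \<in> carrier_mat m m" if "length x = m" for x
    using rdiag_carrier[of x] that by simp
  note dims = carrier_matD[OF W] len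
  define K Ks Kt where "K = sandwich W d e" and "Ks = sandwich W ds es" and "Kt = sandwich W dt et"
  have K: "K \<in> carrier_mat m m" "Ks \<in> carrier_mat m m" "Kt \<in> carrier_mat m m"
    using sandwich_carrier[OF W] len by (auto simp: K_def Ks_def Kt_def)
  have dd: "rdiag d * rdiag d = rdiag ds * rdiag dt"
    using len d by (subst (1 2) rdiag_mult[of _ m]) (auto simp: power2_eq_square intro!: arg_cong[of _ _ rdiag] nth_equalityI)
  \<comment> \<open>\<open>es\<close> is put last so that the second cyclic move carries it to the
    front.\<close>
  have ee: "rdiag e * rdiag e = rdiag et * rdiag es"
    using len e by (subst (1 2) rdiag_mult[of _ m]) (auto simp: power2_eq_square mult.commute intro!: arg_cong[of _ _ rdiag] nth_equalityI)
  define Y where "Y = adj W * (rdiag ds * rdiag dt) * W"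
  have Y: "Y \<in> carrier_mat m m" using W c len by (auto simp: Y_def)
  have "adj K * K = rdiag e * (Y * rdiag e)"
    unfolding K_def adj_sandwich[OF W len(1,2)] unfolding sandwich_def Y_def dd[symmetric]
    by (simp add: assoc_mult_mat_dim dims)
  then have "char_poly (adj K * K) = char_poly (Y * rdiag e * rdiag e)"
    using char_poly_mult_comm[OF c[OF len(2)], of "Y * rdiag e"] Y c len by simp
  also have "Y * rdiag e * rdiag e = Y * rdiag et * rdiag es"
    using Y len by (simp add: assoc_mult_mat_dim carrier_matD[OF Y] ee)
  also have "char_poly \<dots> = char_poly (rdiag es * (Y * rdiag et))"
    using char_poly_mult_comm[of "Y * rdiag et" m "rdiag es"] Y c len by simp
  also have "rdiag es * (Y * rdiag et) = adj Ks * Kt"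
    unfolding Ks_def Kt_def adj_sandwich[OF W len(3,4)] unfolding sandwich_def Y_def
    by (simp add: assoc_mult_mat_dim dims)
  finally have "char_poly (adj Ks * Kt) = (\<Prod>l\<leftarrow>eigs (adj K * K). [:- complex_of_real l, 1:])"
    using hermitian_eigs(3)[OF adj_mult_self_hermitian[OF K(1)]] by simp
  moreover have Z: "adj Ks * Kt \<in> carrier_mat m m" using K by simp
  ultimately have "(top_prod k K)\<^sup>2 \<le> top_prod k (adj Ks * Kt)"
    unfolding top_prod_def[of k K] by (intro prod_eigenvalues_le[OF Z k])
  also have "\<dots> \<le> top_prod k (adj Ks) * top_prod k Kt"
    using K k by (intro top_prod_mult_le) auto
  also have "top_prod k (adj Ks) = top_prod k Ks" using K by (intro top_prod_adj)
  finally show ?thesis by (simp add: K_def Ks_def Kt_def)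
qed

section \<open>Entrywise limits and lower semicontinuity\<close>

lemma tendsto_index_mult:
  fixes A B :: "'b \<Rightarrow> complex mat"
  assumes A: "\<And>t. A t \<in> carrier_mat n p" "A0 \<in> carrier_mat n p"
    and B: "\<And>t. B t \<in> carrier_mat p q" "B0 \<in> carrier_mat p q"
    and limA: "\<And>i j. i < n \<Longrightarrow> j < p \<Longrightarrow> ((\<lambda>t. A t $$ (i, j)) \<longlongrightarrow> A0 $$ (i, j)) F"
    and limB: "\<And>i j. i < p \<Longrightarrow> j < q \<Longrightarrow> ((\<lambda>t. B t $$ (i, j)) \<longlongrightarrow> B0 $$ (i, j)) F"
    and ij: "i < n" "j < q"
  shows "((\<lambda>t. (A t * B t) $$ (i, j)) \<longlongrightarrow> (A0 * B0) $$ (i, j)) F"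
  unfolding index_mult_sum[OF A(1) B(1) ij] index_mult_sum[OF A(2) B(2) ij]
  using limA limB ij by (intro tendsto_sum tendsto_mult) auto

text \<open>By the permutation expansion the determinant is a polynomial in the entries and their
  conjugates.\<close>

lemma tendsto_gram:
  fixes Y :: "'b \<Rightarrow> complex mat"
  assumes Y: "\<And>t. Y t \<in> carrier_mat m k" "Y0 \<in> carrier_mat m k"
    and lim: "\<And>i j. i < m \<Longrightarrow> j < k \<Longrightarrow> ((\<lambda>t. Y t $$ (i, j)) \<longlongrightarrow> Y0 $$ (i, j)) F"
  shows "((\<lambda>t. gram (Y t)) \<longlongrightarrow> gram Y0) F"
proof -
  have adjlim: "((\<lambda>t. adj (Y t) $$ (i, j)) \<longlongrightarrow> adj Y0 $$ (i, j)) F" if "i < k" "j < m" for i j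
    using tendsto_cnj[OF lim[OF that(2,1)]] that carrier_matD[OF Y(1)] carrier_matD[OF Y(2)] by simp
  have ent: "((\<lambda>t. (adj (Y t) * Y t) $$ (i, j)) \<longlongrightarrow> (adj Y0 * Y0) $$ (i, j)) F"
    if "i < k" "j < k" for i j
    using that by (intro tendsto_index_mult[OF adj_carrier[OF Y(1)] adj_carrier[OF Y(2)] Y adjlim lim])
  have c: "adj (Y t) * Y t \<in> carrier_mat k k" "adj Y0 * Y0 \<in> carrier_mat k k" for t
    using adj_mult_self_hermitian(1)[OF Y(1)] adj_mult_self_hermitian(1)[OF Y(2)] by auto
  have "((\<lambda>t. det (adj (Y t) * Y t)) \<longlongrightarrow> det (adj Y0 * Y0)) F"
    unfolding det_def'[OF c(1)] det_def'[OF c(2)]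
  proof (intro tendsto_sum tendsto_mult tendsto_const tendsto_prod)
    fix p i assume "p \<in> {p. p permutes {0..<k}}" "i \<in> {0..<k}"
    then have "i < k" "p i < k" using permutes_in_image by fastforce+
    then show "((\<lambda>t. (adj (Y t) * Y t) $$ (i, p i)) \<longlongrightarrow> (adj Y0 * Y0) $$ (i, p i)) F"
      by (rule ent)
  qed
  then show ?thesis unfolding gram_def by (rule tendsto_norm)
qed

text \<open>Lower semicontinuity is all that is needed of \<^const>\<open>top_prod\<close>: it is a maximum of
  the continuous functions \<open>M \<mapsto> gram (M * X)\<close>.\<close>

lemma top_prod_limit_le:
  fixes M :: "'b \<Rightarrow> complex mat"
  assumes M: "\<And>t. M t \<in> carrier_mat m m" "M0 \<in> carrier_mat m m" and k: "k \<le> m"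
    and lim: "\<And>i j. i < m \<Longrightarrow> j < m \<Longrightarrow> ((\<lambda>t. M t $$ (i, j)) \<longlongrightarrow> M0 $$ (i, j)) F"
    and c: "(c \<longlongrightarrow> c0) F" and le: "eventually (\<lambda>t. top_prod k (M t) \<le> c t) F" and F: "F \<noteq> bot"
  shows "top_prod k M0 \<le> c0"
proof -
  \<comment> \<open>\<open>X\<close> is optimal for the limit \<open>M0\<close> and stays fixed in
    \<open>t\<close>; along the way it gives a lower bound for \<open>top_prod k (M t)\<close>,
    which is the direction needed.\<close>
  obtain X where X: "X \<in> carrier_mat m k" "adj X * X = 1\<^sub>m k" "gram (M0 * X) = top_prod k M0"
    using gram_isometry_attained[OF M(2) k] by blast
  have cX: "M t * X \<in> carrier_mat m k" "M0 * X \<in> carrier_mat m k" for t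
    using mult_carrier_mat[OF M(1) X(1)] mult_carrier_mat[OF M(2) X(1)] by auto
  have "((\<lambda>t. gram (M t * X)) \<longlongrightarrow> gram (M0 * X)) F"
    by (rule tendsto_gram[OF cX]) (rule tendsto_index_mult[OF M X(1) X(1) lim], auto)
  moreover have "eventually (\<lambda>t. gram (M t * X) \<le> c t) F"
    using le by eventually_elim (use gram_isometry_le[OF M(1) X(1,2) k] order_trans in blast)
  ultimately have "gram (M0 * X) \<le> c0" using tendsto_le[OF F c] by blast
  then show ?thesis by (simp add: X)
qed

text \<open>A gap argument: a missing point t lies strictly between the nearest points of S on
  either side, and their midpoint belongs to S although it falls into the gap. Closure points are
  required to lie in S just inside (0,1), because 0 and 1 are in S already.\<close>

lemma midpoint_closed_imp_interval:
  fixes S :: "real set"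
  assumes S: "S \<subseteq> {0..1}" "0 \<in> S" "1 \<in> S"
    and mid: "\<And>s t. s \<in> S \<Longrightarrow> t \<in> S \<Longrightarrow> (s + t) / 2 \<in> S"
    and cl: "\<And>t. 0 < t \<Longrightarrow> t < 1 \<Longrightarrow> t \<in> closure S \<Longrightarrow> t \<in> S"
  shows "S = {0..1}"
proof -
  have "closure S \<subseteq> {0..1}" using S(1) by (rule closure_minimal) simp
  have "closure S \<subseteq> S"
  proof
    fix t assume t: "t \<in> closure S"
    then have "0 \<le> t" "t \<le> 1" using \<open>closure S \<subseteq> {0..1}\<close> by auto
    then consider "t = 0" | "t = 1" | "0 < t" "t < 1" by linarith
    then show "t \<in> S" using S cl t by cases auto
  qed
  then have closed: "closed S" using closure_subset closure_eq by blast
  have "t \<in> S" if t: "t \<in> {0..1}" for t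
  proof (rule ccontr)
    assume "t \<notin> S"
    have ne: "S \<inter> {..t} \<noteq> {}" "S \<inter> {t..} \<noteq> {}" using S(2,3) t by auto
    have bd: "bdd_above (S \<inter> {..t})" "bdd_below (S \<inter> {t..})" by auto
    define a b where "a = Sup (S \<inter> {..t})" and "b = Inf (S \<inter> {t..})"
    have a: "a \<in> S" "a \<le> t"
      using closed_contains_Sup[OF ne(1) bd(1) closed_Int[OF closed closed_atMost]] by (auto simp: a_def)
    have b: "b \<in> S" "t \<le> b"
      using closed_contains_Inf[OF ne(2) bd(2) closed_Int[OF closed closed_atLeast]] by (auto simp: b_def)
    have ab: "a < t" "t < b" using a b \<open>t \<notin> S\<close> by (auto simp: order.order_iff_strict)
    have m: "(a + b) / 2 \<in> S" using mid a b by blast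
    show False
    proof (cases "(a + b) / 2 \<le> t")
      case True
      then have "(a + b) / 2 \<le> a" using m cSup_upper[OF _ bd(1), of "(a + b) / 2"] by (simp add: a_def)
      then show False using ab by simp
    next
      case False
      then have "b \<le> (a + b) / 2" using m cInf_lower[OF _ bd(2), of "(a + b) / 2"] by (simp add: b_def)
      then show False using ab by simp
    qed
  qed
  then show ?thesis using S by blast
qed

section \<open>Powers and weighted geometric means under both conventions\<close>

context
  fixes pw :: "real \<Rightarrow> real \<Rightarrow> real"
  assumes pw: "pw = pow_conv1 \<or> pw = pow_conv2"
begin

lemma pw_nonneg: "0 \<le> pw x p"
  using pw by (auto simp: pow_conv1_def pow_conv2_def)

lemma pw_mult: "0 \<le> x \<Longrightarrow> 0 \<le> y \<Longrightarrow> pw (x * y) p = pw x p * pw y p"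
  using pw by (auto simp: pow_conv1_def pow_conv2_def powr_mult)

lemma pw_one: "pw 1 p = 1"
  using pw by (auto simp: pow_conv1_def pow_conv2_def)

lemma pw_mono: "0 \<le> x \<Longrightarrow> x \<le> y \<Longrightarrow> 0 \<le> p \<Longrightarrow> pw x p \<le> pw y p"
  using pw by (auto simp: pow_conv1_def pow_conv2_def powr_mono2)

lemma pw_pos: "0 < p \<Longrightarrow> pw x p = x powr p"
  using pw by (auto simp: pow_conv1_def pow_conv2_def)

lemma pw_sqrt: "0 \<le> x \<Longrightarrow> pw (sqrt x) p = sqrt (pw x p)"
  using pw_mult[of "sqrt x" "sqrt x" p] pw_nonneg[of "sqrt x" p]
  by (simp add: real_sqrt_unique power2_eq_square)

end

definition wmean :: "(real \<Rightarrow> real \<Rightarrow> real) \<Rightarrow> real \<Rightarrow> real \<Rightarrow> real \<Rightarrow> real" where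
  "wmean pw t x y = pw x t * pw y (1 - t)"

text \<open>For base 0 the exponents must be nonnegative: their midpoint is then 0 just when both
  are, so 0^0 = 1 is consistent with the product.\<close>

lemma pow_conv1_midpoint:
  assumes "0 \<le> x" "0 \<le> s" "0 \<le> t"
  shows "(pow_conv1 x ((s + t) / 2))\<^sup>2 = pow_conv1 x s * pow_conv1 x t"
proof -
  have "(x powr (p / 2))\<^sup>2 = x powr p" for p
    using powr_add[of x "p / 2" "p / 2"] by (simp add: power2_eq_square)
  then show ?thesis using assms powr_add[of x s t] by (auto simp: pow_conv1_def)
qed

lemma wmean_conv1_midpoint:
  assumes "0 \<le> x" "0 \<le> y" "s \<in> {0..1}" "t \<in> {0..1}"
  shows "(wmean pow_conv1 ((s + t) / 2) x y)\<^sup>2 = wmean pow_conv1 s x y * wmean pow_conv1 t x y"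
proof -
  have e: "1 - (s + t) / 2 = ((1 - s) + (1 - t)) / 2" by (simp add: field_simps)
  have "(pow_conv1 y (1 - (s + t) / 2))\<^sup>2 = pow_conv1 y (1 - s) * pow_conv1 y (1 - t)"
    unfolding e using assms by (intro pow_conv1_midpoint) auto
  then show ?thesis
    using assms pow_conv1_midpoint[of x s t] by (simp add: wmean_def power_mult_distrib)
qed

text \<open>At base 0 the power is constantly 0. This continuity in the exponent is what the first
  convention loses at exponent 0.\<close>

lemma tendsto_powr_exponent:
  fixes x :: real
  assumes "(f \<longlongrightarrow> p) F"
  shows "((\<lambda>s. x powr f s) \<longlongrightarrow> x powr p) F"
  using assms by (cases "x = 0") (auto intro: tendsto_powr)

lemma tendsto_wmean_conv2:
  "((\<lambda>s. wmean pow_conv2 s x y) \<longlongrightarrow> wmean pow_conv2 t x y) (at t within S)"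
  unfolding wmean_def pow_conv2_def by (intro tendsto_intros tendsto_powr_exponent)

lemma wmean_conv1_eq: "0 < t \<Longrightarrow> t < 1 \<Longrightarrow> wmean pow_conv1 t x y = wmean pow_conv2 t x y"
  by (simp add: wmean_def pow_conv1_def pow_conv2_def)

lemma tendsto_wmean_conv1:
  assumes "0 < t" "t < 1"
  shows "((\<lambda>s. wmean pow_conv1 s x y) \<longlongrightarrow> wmean pow_conv1 t x y) (at t within S)"
proof (rule Lim_transform_eventually)
  show "((\<lambda>s. wmean pow_conv2 s x y) \<longlongrightarrow> wmean pow_conv1 t x y) (at t within S)"
    using tendsto_wmean_conv2 assms by (simp add: wmean_conv1_eq)
  have "eventually (\<lambda>s. s \<in> {0<..<1}) (at t within S)"
    using assms by (intro eventually_at_topological[THEN iffD2] exI[of _ "{0<..<1}"]) auto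
  then show "eventually (\<lambda>s. wmean pow_conv2 s x y = wmean pow_conv1 s x y) (at t within S)"
    by eventually_elim (auto simp: wmean_conv1_eq)
qed

lemma tendsto_sandwich_index:
  assumes "W \<in> carrier_mat m m" "length d1 = m" "length d2 = m" "length e1 = m" "length e2 = m"
    and lim: "\<And>x y. ((\<lambda>s. f s x y) \<longlongrightarrow> g x y) F" and ij: "i < m" "j < m"
  shows "((\<lambda>s. sandwich W (map2 (f s) d1 d2) (map2 (f s) e1 e2) $$ (i, j)) \<longlongrightarrow>
    sandwich W (map2 g d1 d2) (map2 g e1 e2) $$ (i, j)) F"
proof -
  have "sandwich W (map2 h d1 d2) (map2 h e1 e2) $$ (i, j) =
      complex_of_real (h (d1 ! i) (d2 ! i)) * W $$ (i, j) * complex_of_real (h (e1 ! j) (e2 ! j))" for h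
    using assms by (subst index_sandwich[of W m]) auto
  then show ?thesis by (simp only:) (intro tendsto_intros lim)
qed

text \<open>\<open>S\<close> collects the exponents at which the bound holds under the first
  convention. It contains 0 and 1 by equality, is closed under midpoints, and is closed in (0,1), so
  it is the whole interval. The second convention agrees with the first in the interior and is
  continuous up to the ends.\<close>

lemma top_prod_wmean_le:
  assumes W: "W \<in> carrier_mat m m" and k: "k \<le> m"
    and len: "length d1 = m" "length d2 = m" "length e1 = m" "length e2 = m"
    and nn: "\<And>x. x \<in> set d1 \<union> set d2 \<union> set e1 \<union> set e2 \<Longrightarrow> 0 \<le> x"
    and \<theta>: "\<theta> \<in> {0..1}" and pw: "pw = pow_conv1 \<or> pw = pow_conv2"
  shows "top_prod k (sandwich W (map2 (wmean pw \<theta>) d1 d2) (map2 (wmean pw \<theta>) e1 e2)) \<le>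
    wmean pw \<theta> (top_prod k (sandwich W d1 e1)) (top_prod k (sandwich W d2 e2))"
proof -
  define K where "K pw t = sandwich W (map2 (wmean pw t) d1 d2) (map2 (wmean pw t) e1 e2)" for pw t
  define c1 c2 where "c1 = top_prod k (sandwich W d1 e1)" and "c2 = top_prod k (sandwich W d2 e2)"
  have K: "K pw t \<in> carrier_mat m m" for pw t
    unfolding K_def using W len by (intro sandwich_carrier) auto
  have c: "0 \<le> c1" "0 \<le> c2"
    unfolding c1_def c2_def using sandwich_carrier[OF W] len top_prod_nonneg by metis+
  define S where "S = {t \<in> {0..1}. top_prod k (K pow_conv1 t) \<le> wmean pow_conv1 t c1 c2}"
  have "S = {0..1}"
  proof (rule midpoint_closed_imp_interval)
    have e: "map2 (wmean pow_conv1 0) x1 x2 = x2" "map2 (wmean pow_conv1 1) x1 x2 = x1"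
      if "length x1 = length x2" "\<And>x. x \<in> set x1 \<union> set x2 \<Longrightarrow> 0 \<le> x" for x1 x2
      using that by (auto intro!: nth_equalityI simp: wmean_def pow_conv1_def)
    have "K pow_conv1 0 = sandwich W d2 e2" "K pow_conv1 1 = sandwich W d1 e1"
      unfolding K_def using e[of d1 d2] e[of e1 e2] len nn by simp_all
    then show "0 \<in> S" "1 \<in> S"
      using c by (auto simp: S_def wmean_def pow_conv1_def c1_def c2_def)
    show "S \<subseteq> {0..1}" by (auto simp: S_def)
    fix s t assume "s \<in> S" "t \<in> S"
    then have st: "s \<in> {0..1}" "t \<in> {0..1}"
      and le: "top_prod k (K pow_conv1 s) \<le> wmean pow_conv1 s c1 c2" "top_prod k (K pow_conv1 t) \<le> wmean pow_conv1 t c1 c2"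
      by (auto simp: S_def)
    have "(top_prod k (K pow_conv1 ((s + t) / 2)))\<^sup>2 \<le> top_prod k (K pow_conv1 s) * top_prod k (K pow_conv1 t)"
      unfolding K_def using len nn st
      by (intro top_prod_sandwich_midpoint[OF W k]) (simp_all add: wmean_conv1_midpoint)
    also have "\<dots> \<le> wmean pow_conv1 s c1 c2 * wmean pow_conv1 t c1 c2"
      using le by (intro mult_mono top_prod_nonneg[OF K]) (auto simp: wmean_def pw_nonneg)
    also have "\<dots> = (wmean pow_conv1 ((s + t) / 2) c1 c2)\<^sup>2"
      using st c by (simp add: wmean_conv1_midpoint)
    \<comment> \<open>The bound satisfies the midpoint relation with equality, so both sides are
      squares of nonnegative numbers.\<close>
    finally have "top_prod k (K pow_conv1 ((s + t) / 2)) \<le> wmean pow_conv1 ((s + t) / 2) c1 c2"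
      by (rule power2_le_imp_le) (auto simp: wmean_def pw_nonneg)
    then show "(s + t) / 2 \<in> S" using st by (auto simp: S_def)
  next
    fix t :: real assume t: "0 < t" "t < 1" "t \<in> closure S"
    show "t \<in> S"
    proof (rule ccontr)
      assume "t \<notin> S"
      \<comment> \<open>A closure point outside \<open>S\<close> is a limit point, so the limit is
        taken along exponents where the bound is known.\<close>
      then have F: "at t within S \<noteq> bot" using t(3) by (simp add: closure_def trivial_limit_within)
      have "eventually (\<lambda>s. top_prod k (K pow_conv1 s) \<le> wmean pow_conv1 s c1 c2) (at t within S)"
        by (intro eventually_at_topological[THEN iffD2] exI[of _ UNIV]) (auto simp: S_def)
      moreover have "((\<lambda>s. K pow_conv1 s $$ (i, j)) \<longlongrightarrow> K pow_conv1 t $$ (i, j)) (at t within S)"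
        if "i < m" "j < m" for i j
        unfolding K_def by (intro tendsto_sandwich_index[OF W len] tendsto_wmean_conv1 t that)
      ultimately have "top_prod k (K pow_conv1 t) \<le> wmean pow_conv1 t c1 c2"
        by (intro top_prod_limit_le[OF K K k _ tendsto_wmean_conv1[OF t(1,2)] _ F])
      then show False using \<open>t \<notin> S\<close> t by (simp add: S_def)
    qed
  qed
  then have conv1: "top_prod k (K pow_conv1 t) \<le> wmean pow_conv1 t c1 c2" if "t \<in> {0..1}" for t
    using that unfolding S_def by blast
  \<comment> \<open>The limit runs through the open interval for every \<theta>, interior or not; no
    case split on the value of \<theta> is needed beyond checking that it is a limit point.\<close>
  have "top_prod k (K pow_conv2 \<theta>) \<le> wmean pow_conv2 \<theta> c1 c2"
  proof (rule top_prod_limit_le[OF K K k])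
    consider "\<theta> = 0" | "\<theta> = 1" | "\<theta> \<in> {0<..<1}" using \<theta> by force
    then have "\<theta> islimpt {0<..<1}"
    proof cases
      case 1
      then show ?thesis using islimpt_greaterThanLessThan1[of 0 "1::real"] by simp
    next
      case 2
      then show ?thesis using islimpt_greaterThanLessThan2[of 0 "1::real"] by simp
    next
      case 3
      then show ?thesis by (intro interior_limit_point) (simp add: interior_open)
    qed
    then show "at \<theta> within {0<..<1} \<noteq> bot" by (simp add: trivial_limit_within)
    show "((\<lambda>s. wmean pow_conv2 s c1 c2) \<longlongrightarrow> wmean pow_conv2 \<theta> c1 c2) (at \<theta> within {0<..<1})"
      by (rule tendsto_wmean_conv2)
    show "((\<lambda>s. K pow_conv2 s $$ (i, j)) \<longlongrightarrow> K pow_conv2 \<theta> $$ (i, j)) (at \<theta> within {0<..<1})"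
      if "i < m" "j < m" for i j
      unfolding K_def by (intro tendsto_sandwich_index[OF W len] tendsto_wmean_conv2 that)
    have "top_prod k (K pow_conv2 s) \<le> wmean pow_conv2 s c1 c2" if "0 < s" "s < 1" for s
    proof -
      have "wmean pow_conv1 s = wmean pow_conv2 s" using that by (intro ext wmean_conv1_eq)
      then show ?thesis using conv1[of s] that by (simp add: K_def)
    qed
    then show "eventually (\<lambda>s. top_prod k (K pow_conv2 s) \<le> wmean pow_conv2 s c1 c2) (at \<theta> within {0<..<1})"
      by (intro eventually_at_topological[THEN iffD2] exI[of _ UNIV]) auto
  qed
  then show ?thesis using conv1[OF \<theta>] pw by (auto simp: K_def c1_def c2_def)
qed

section \<open>The case k = m and the assembly of the log-majorization\<close>

lemma prod_list_map2_wmean: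
  assumes pw: "pw = pow_conv1 \<or> pw = pow_conv2"
    and "length xs = length ys" "\<forall>x\<in>set xs. 0 \<le> x" "\<forall>y\<in>set ys. 0 \<le> y"
  shows "prod_list (map2 (wmean pw t) xs ys) = wmean pw t (prod_list xs) (prod_list ys)"
  using assms(2-)
proof (induction xs ys rule: list_induct2)
  case Nil
  then show ?case by (simp add: wmean_def pw_one[OF pw])
next
  case (Cons x xs y ys)
  have "0 \<le> prod_list xs" "0 \<le> prod_list ys" using Cons.prems by (auto intro: prod_list_nonneg)
  then show ?case using Cons by (simp add: wmean_def pw_mult[OF pw])
qed

lemma top_prod_full:
  assumes "M \<in> carrier_mat m m"
  shows "top_prod m M = (cmod (det M))\<^sup>2"
proof -
  note h = hermitian_eigs[OF adj_mult_self_hermitian[OF assms]]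
  obtain U where U: "unitary m U" and e: "adj M * M = U * rdiag (eigs (adj M * M)) * adj U" using h(4) by blast
  note UU = unitaryD[OF U]
  have c: "rdiag (eigs (adj M * M)) \<in> carrier_mat m m" using rdiag_carrier h(1) by metis
  have "det U * det (adj U) = 1" using arg_cong[OF UU(3), of det] det_mult[OF UU(1,2)] by simp
  then have "det (U * rdiag (eigs (adj M * M)) * adj U) = det (rdiag (eigs (adj M * M)))"
    using UU c by (simp add: det_mult[of _ m])
  then have "det (adj M * M) = complex_of_real (prod_list (eigs (adj M * M)))"
    using e det_rdiag by metis
  moreover have "det (adj M * M) = complex_of_real ((cmod (det M))\<^sup>2)"
    using assms by (simp add: det_mult[of _ m] det_adj mult_cnj_cmod[symmetric] mult.commute del: of_real_power)
  ultimately show ?thesis using h(1) by (simp add: top_prod_def del: of_real_power)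
qed

text \<open>For k = m the quantity is a squared modulus of a determinant. The unitary
  \<open>W\<close> contributes modulus 1, and what remains is a product of diagonal entries, on
  which the weighted mean is multiplicative.\<close>

lemma top_prod_wmean_full:
  assumes W: "unitary m W"
    and len: "length d1 = m" "length d2 = m" "length e1 = m" "length e2 = m"
    and nn: "\<And>x. x \<in> set d1 \<union> set d2 \<union> set e1 \<union> set e2 \<Longrightarrow> 0 \<le> x"
    and pw: "pw = pow_conv1 \<or> pw = pow_conv2"
  shows "top_prod m (sandwich W (map2 (wmean pw \<theta>) d1 d2) (map2 (wmean pw \<theta>) e1 e2)) =
    wmean pw \<theta> (top_prod m (sandwich W d1 e1)) (top_prod m (sandwich W d2 e2))"
proof -
  note WU = unitaryD[OF W]
  have "det W * cnj (det W) = 1"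
    using arg_cong[OF WU(3), of det] det_mult[OF WU(1,2)] det_adj[OF WU(1)] by simp
  then have "complex_of_real ((cmod (det W))\<^sup>2) = complex_of_real 1" unfolding mult_cnj_cmod by simp
  then have detW: "(cmod (det W))\<^sup>2 = 1" by (simp only: of_real_eq_iff)
  have tp: "top_prod m (sandwich W d e) = (prod_list d)\<^sup>2 * (prod_list e)\<^sup>2"
    if "length d = m" "length e = m" for d e
  proof -
    have c: "rdiag d \<in> carrier_mat m m" "rdiag e \<in> carrier_mat m m" using that rdiag_carrier by metis+
    have "det (sandwich W d e) = complex_of_real (prod_list d) * det W * complex_of_real (prod_list e)"
      unfolding sandwich_def using c WU(1) by (simp add: det_mult[of _ m] det_rdiag)
    then have "(cmod (det (sandwich W d e)))\<^sup>2 = (prod_list d)\<^sup>2 * (cmod (det W))\<^sup>2 * (prod_list e)\<^sup>2"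
      by (simp add: norm_mult power_mult_distrib)
    then show ?thesis using top_prod_full[OF sandwich_carrier[OF WU(1) that]] detW by simp
  qed
  have nonneg: "0 \<le> prod_list d1" "0 \<le> prod_list d2" "0 \<le> prod_list e1" "0 \<le> prod_list e2"
    using nn by (auto intro!: prod_list_nonneg)
  show ?thesis
    using len nn nonneg
    by (simp add: tp prod_list_map2_wmean[OF pw] power2_eq_square)
      (simp add: wmean_def pw_mult[OF pw])
qed

lemma log_majorized_sorted:
  assumes "length a = m" "length b = m" "sorted_wrt (\<ge>) a" "sorted_wrt (\<ge>) b"
    and "\<And>k. k \<le> m \<Longrightarrow> prod_list (take k a) \<le> prod_list (take k b)" "prod_list a = prod_list b"
  shows "log_majorized a b"
  using assms by (simp add: log_majorized_def sort_sorted_wrt_ge)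

lemma sqrt_prod_list: "sqrt (prod_list xs) = prod_list (map sqrt xs)"
  by (induction xs) (auto simp: real_sqrt_mult)

text \<open>Two forms for two uses: the first with square roots of the original eigenvalues as
  diagonals, the second with the eigenvalues themselves, where the roots turn squared singular
  values into singular values.\<close>

lemma log_majorized_wmean:
  assumes W: "unitary m W"
    and len: "length d1 = m" "length d2 = m" "length e1 = m" "length e2 = m"
    and nn: "\<And>x. x \<in> set d1 \<union> set d2 \<union> set e1 \<union> set e2 \<Longrightarrow> 0 \<le> x"
    and \<theta>: "\<theta> \<in> {0..1}" and pw: "pw = pow_conv1 \<or> pw = pow_conv2"
  defines "\<sigma> \<equiv> \<lambda>d e. eigs (adj (sandwich W d e) * sandwich W d e)"
  defines "d \<equiv> map2 (wmean pw \<theta>) d1 d2" and "e \<equiv> map2 (wmean pw \<theta>) e1 e2"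
  shows "log_majorized (\<sigma> d e) (map2 (wmean pw \<theta>) (\<sigma> d1 e1) (\<sigma> d2 e2))"
    "log_majorized (map sqrt (\<sigma> d e)) (map2 (wmean pw \<theta>) (map sqrt (\<sigma> d1 e1)) (map sqrt (\<sigma> d2 e2)))"
proof -
  note WU = unitaryD[OF W]
  have len': "length d = m" "length e = m" using len by (auto simp: d_def e_def)
  have l: "length (\<sigma> x y) = m" and s: "sorted_wrt (\<ge>) (\<sigma> x y)" and n: "\<forall>z\<in>set (\<sigma> x y). 0 \<le> z"
    if "length x = m" "length y = m" for x y
    using hermitian_eigs(1,2)[OF adj_mult_self_hermitian[OF sandwich_carrier[OF WU(1) that]]]
      eigs_adj_mult_self_nonneg[OF sandwich_carrier[OF WU(1) that]] by (auto simp: \<sigma>_def)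
  define b where "b = map2 (wmean pw \<theta>) (\<sigma> d1 e1) (\<sigma> d2 e2)"
  have lb: "length b = m" using len by (simp add: b_def l)
  have nth_nn: "0 \<le> \<sigma> x y ! i" if "length x = m" "length y = m" "i < m" for x y i
    using n[OF that(1,2)] l[OF that(1,2)] that by (metis nth_mem)
  \<comment> \<open>Powers with nonnegative exponent are monotone, so the list of means is already
    decreasing and the rearrangement in \<open>log_majorized\<close> does nothing.\<close>
  have sb: "sorted_wrt (\<ge>) b"
    unfolding sorted_wrt_iff_nth_less
  proof (intro allI impI)
    fix i j assume ij: "i < j" "j < length b"
    then have "\<sigma> d1 e1 ! j \<le> \<sigma> d1 e1 ! i" "\<sigma> d2 e2 ! j \<le> \<sigma> d2 e2 ! i"
      using s[of d1 e1] s[of d2 e2] l[of d1 e1] l[of d2 e2] len lb unfolding sorted_wrt_iff_nth_less by auto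
    then show "b ! j \<le> b ! i"
      using ij len lb \<theta> by (simp add: b_def l wmean_def)
        (intro mult_mono pw_mono[OF pw] pw_nonneg[OF pw], auto simp: nth_nn)
  qed
  have tb: "prod_list (take k b) = wmean pw \<theta> (top_prod k (sandwich W d1 e1)) (top_prod k (sandwich W d2 e2))" for k
  proof -
    have "take k b = map2 (wmean pw \<theta>) (take k (\<sigma> d1 e1)) (take k (\<sigma> d2 e2))"
      by (simp add: b_def take_map take_zip)
    moreover have "prod_list (map2 (wmean pw \<theta>) (take k (\<sigma> d1 e1)) (take k (\<sigma> d2 e2))) =
        wmean pw \<theta> (prod_list (take k (\<sigma> d1 e1))) (prod_list (take k (\<sigma> d2 e2)))"
      using len n[of d1 e1] n[of d2 e2]
      by (intro prod_list_map2_wmean[OF pw]) (auto simp: l dest: in_set_takeD)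
    ultimately show ?thesis by (simp only: top_prod_def \<sigma>_def)
  qed
  have le: "prod_list (take k (\<sigma> d e)) \<le> prod_list (take k b)" if "k \<le> m" for k
    using top_prod_wmean_le[OF WU(1) that len nn \<theta> pw] by (simp add: tb top_prod_def \<sigma>_def d_def e_def)
  have "prod_list (take m (\<sigma> d e)) = prod_list (take m b)"
    using top_prod_wmean_full[OF W len nn pw] by (simp add: tb top_prod_def \<sigma>_def d_def e_def)
  then have eq: "prod_list (\<sigma> d e) = prod_list b" using l[OF len'] lb by simp
  show "log_majorized (\<sigma> d e) (map2 (wmean pw \<theta>) (\<sigma> d1 e1) (\<sigma> d2 e2))"
    unfolding b_def[symmetric]
    using l[OF len'] lb s[OF len'] sb le eq by (rule log_majorized_sorted)
  have "map2 (wmean pw \<theta>) (map sqrt (\<sigma> d1 e1)) (map sqrt (\<sigma> d2 e2)) = map sqrt b"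
    using len by (intro nth_equalityI) (auto simp: b_def l wmean_def pw_sqrt[OF pw] nth_nn real_sqrt_mult)
  moreover have "log_majorized (map sqrt (\<sigma> d e)) (map sqrt b)"
  proof (rule log_majorized_sorted)
    show "sorted_wrt (\<ge>) (map sqrt (\<sigma> d e))" "sorted_wrt (\<ge>) (map sqrt b)"
      using s[OF len'] sb by (simp_all add: sorted_wrt_map)
    show "prod_list (take k (map sqrt (\<sigma> d e))) \<le> prod_list (take k (map sqrt b))" if "k \<le> m" for k
      using le[OF that] by (simp add: take_map sqrt_prod_list[symmetric])
  qed (use l[OF len'] lb eq in \<open>simp_all add: sqrt_prod_list[symmetric]\<close>)
  ultimately show "log_majorized (map sqrt (\<sigma> d e))
      (map2 (wmean pw \<theta>) (map sqrt (\<sigma> d1 e1)) (map sqrt (\<sigma> d2 e2)))" by simp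
qed

subsection \<open>Functional calculus and reduction to the diagonal path\<close>

text \<open>Well-definedness of the functional calculus. For two diagonalizations,
  \<open>adj V * U\<close> intertwines the two diagonal matrices, and it still does after
  \<open>f\<close> is applied to both.\<close>

lemma mfun_unitary_rdiag:
  assumes U: "unitary n U" and ls: "length ls = n"
  shows "mfun f (U * rdiag ls * adj U) = U * rdiag (map f ls) * adj U"
proof -
  note UU = unitaryD[OF U]
  have c: "rdiag xs \<in> carrier_mat n n" if "length xs = n" for xs
    using rdiag_carrier[of xs] that by simp
  define A where "A = U * rdiag ls * adj U"
  have A: "A \<in> carrier_mat n n" "dim_row A = n" using UU c[OF ls] by (auto simp: A_def)
  have "mfun f A = U * rdiag (map f ls) * adj U"
    unfolding mfun_def
  proof (rule some_equality)
    show "\<exists>U' ks. unitary (dim_row A) U' \<and> length ks = dim_row A \<and> A = U' * rdiag ks * adj U' \<and>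
        U * rdiag (map f ls) * adj U = U' * rdiag (map f ks) * adj U'"
      using U ls A by (intro exI[of _ U] exI[of _ ls]) (simp add: A_def)
  next
    fix B assume "\<exists>V ks. unitary (dim_row A) V \<and> length ks = dim_row A \<and> A = V * rdiag ks * adj V \<and>
        B = V * rdiag (map f ks) * adj V"
    then obtain V ks where V: "unitary n V" and ks: "length ks = n" "A = V * rdiag ks * adj V"
      and B: "B = V * rdiag (map f ks) * adj V" using A(2) by auto
    note VV = unitaryD[OF V]
    define W where "W = adj V * U"
    have W: "W \<in> carrier_mat n n" using UU VV by (simp add: W_def)
    note dims = carrier_matD[OF UU(1)] carrier_matD[OF VV(1)] carrier_matD[OF W] ls ks(1)
    have "W * rdiag ls \<in> carrier_mat n n" using W c[OF ls] by simp
    then have "W * rdiag ls = W * rdiag ls * (adj U * U)" unfolding UU(4) by (rule right_mult_one_mat[symmetric])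
    also have "\<dots> = adj V * (U * rdiag ls * adj U) * U"
      unfolding W_def by (simp add: assoc_mult_mat_dim dims)
    also have "U * rdiag ls * adj U = V * rdiag ks * adj V" using ks(2) by (simp add: A_def)
    also have "adj V * (V * rdiag ks * adj V) * U = (adj V * V) * (rdiag ks * W)"
      unfolding W_def by (simp add: assoc_mult_mat_dim dims)
    also have "\<dots> = rdiag ks * W"
      unfolding VV(4) using W c[OF ks(1)] by (intro left_mult_one_mat[of _ n n]) simp
    finally have inter: "W * rdiag ls = rdiag ks * W" .
    have ent: "(W * rdiag xs) $$ (i, j) = W $$ (i, j) * complex_of_real (xs ! j)"
      "(rdiag xs * W) $$ (i, j) = complex_of_real (xs ! i) * W $$ (i, j)"
      if "length xs = n" "i < n" "j < n" for xs i j
    proof -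
      have one: "rdiag (replicate n 1) = 1\<^sub>m n" by (rule eq_matI) auto
      show "(W * rdiag xs) $$ (i, j) = W $$ (i, j) * complex_of_real (xs ! j)"
        using index_sandwich[OF W _ that(1), of "replicate n 1" i j] that W
        by (simp add: sandwich_def one)
      show "(rdiag xs * W) $$ (i, j) = complex_of_real (xs ! i) * W $$ (i, j)"
        using index_sandwich[OF W that(1), of "replicate n 1" i j] that W c[OF that(1)]
        by (simp add: sandwich_def one)
    qed
    have "W * rdiag (map f ls) = rdiag (map f ks) * W"
    proof (rule eq_matI)
      fix i j assume "i < dim_row (rdiag (map f ks) * W)" "j < dim_col (rdiag (map f ks) * W)"
      then have ij: "i < n" "j < n" using W ks by auto
      have "W $$ (i, j) * complex_of_real (ls ! j) = complex_of_real (ks ! i) * W $$ (i, j)"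
        using ent(1)[OF ls ij] ent(2)[OF ks(1) ij] unfolding inter by (rule trans[OF sym])
      \<comment> \<open>Wherever \<open>W\<close> has a nonzero entry the two eigenvalues coincide,
        hence so do their images under \<open>f\<close>.\<close>
      then have "W $$ (i, j) = 0 \<or> ls ! j = ks ! i" by auto
      then show "(W * rdiag (map f ls)) $$ (i, j) = (rdiag (map f ks) * W) $$ (i, j)"
        using ent(1)[of "map f ls" i j] ent(2)[of "map f ks" i j] ij ls ks(1)
        by (auto simp del: index_mult_mat(1))
    qed (use W ls ks in auto)
    then have "V * (W * rdiag (map f ls)) * adj U = V * (rdiag (map f ks) * W) * adj U" by simp
    also have "V * (W * rdiag (map f ls)) * adj U = (V * adj V) * (U * rdiag (map f ls) * adj U)"
      unfolding W_def by (simp add: assoc_mult_mat_dim dims)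
    also have "V * (rdiag (map f ks) * W) * adj U = (V * rdiag (map f ks) * adj V) * (U * adj U)"
      unfolding W_def by (simp add: assoc_mult_mat_dim dims)
    finally show "B = U * rdiag (map f ls) * adj U"
      using VV UU c[of "map f ls"] c[of "map f ks"] ls ks B by simp
  qed
  then show ?thesis by (simp add: A_def)
qed

text \<open>Each diagonal entry is the value of the quadratic form of \<open>A\<close> at a column
  of \<open>U\<close>.\<close>

lemma psd_unitary_rdiag_nonneg:
  assumes A: "psd n A" "A = U * rdiag as * adj U" and U: "unitary n U" and len: "length as = n"
    and x: "x \<in> set as"
  shows "0 \<le> x"
proof -
  note UU = unitaryD[OF U]
  have cA: "A \<in> carrier_mat n n" using A by (simp add: psd_def)
  obtain i where i: "i < n" "x = as ! i" using x len by (metis in_set_conv_nth)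
  have "rdiag as \<in> carrier_mat n n" using rdiag_carrier len by metis
  from iffD2[OF unitary_conj_swap[OF U cA this] A(2)]
  have "complex_of_real x = (adj U * A * U) $$ (i, i)" using i len by simp
  also have "adj U * A * U = adj U * (A * U)" using UU cA by (intro assoc_mult_mat) auto
  also have "\<dots> $$ (i, i) = row (adj U) i \<bullet> col (A * U) i" using UU cA i by simp
  also have "col (A * U) i = A *\<^sub>v col U i" using col_mult2[OF cA UU(1) i(1)] .
  also have "row (adj U) i = conjugate (col U i)" using UU i by (intro eq_vecI) auto
  finally have "x = Re (conjugate (col U i) \<bullet> (A *\<^sub>v col U i))" by (metis Re_complex_of_real)
  then show ?thesis using A(1) UU i by (auto simp: psd_def)
qed

lemma commuting_psd_diagonalization:
  assumes "psd m A1" "psd m A2" "A1 * A2 = A2 * A1"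
  obtains U a1 a2 where "unitary m U" "length a1 = m" "length a2 = m"
    "A1 = U * rdiag a1 * adj U" "A2 = U * rdiag a2 * adj U" "\<And>x. x \<in> set a1 \<union> set a2 \<Longrightarrow> 0 \<le> x"
proof -
  have h: "A1 \<in> carrier_mat m m" "adj A1 = A1" "A2 \<in> carrier_mat m m" "adj A2 = A2"
    using assms by (auto simp: psd_def)
  obtain U a1 a2 where *: "unitary m U" "length a1 = m" "length a2 = m"
    "A1 = U * rdiag a1 * adj U" "A2 = U * rdiag a2 * adj U"
    using simultaneous_diagonalization[OF h assms(3)] by blast
  then show thesis
    using that psd_unitary_rdiag_nonneg[OF assms(1) *(4,1,2)] psd_unitary_rdiag_nonneg[OF assms(2) *(5,1,3)]
    by blast
qed

lemma unitary_rdiag_mult: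
  assumes U: "unitary m U" and len: "length a = m" "length b = m"
  shows "(U * rdiag a * adj U) * (U * rdiag b * adj U) = U * rdiag (map2 (*) a b) * adj U"
proof -
  note UU = unitaryD[OF U]
  note dims = carrier_matD[OF UU(1)] len
  have c: "rdiag b \<in> carrier_mat m m" using rdiag_carrier len by metis
  have "(U * rdiag a * adj U) * (U * rdiag b * adj U) = U * rdiag a * (adj U * U) * (rdiag b * adj U)"
    by (simp add: assoc_mult_mat_dim dims)
  also have "\<dots> = U * (rdiag a * rdiag b) * adj U"
    using c UU by (simp add: assoc_mult_mat_dim dims)
  finally show ?thesis by (simp add: rdiag_mult[OF len])
qed

text \<open>A B is a sandwich between unitaries, which do not affect singular values. With half
  powers, R B R is unitarily similar to K1 times its adjoint, and the order of these two factors
  does not matter for the spectrum.\<close>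

lemma eigs_sandwich_products:
  assumes U: "unitary m U" and V: "unitary m V" and len: "length a = m" "length b = m"
    and nn: "\<And>x. x \<in> set a \<union> set b \<Longrightarrow> 0 \<le> x" and W: "W = adj U * V"
  defines "A \<equiv> U * rdiag a * adj U" and "B \<equiv> V * rdiag b * adj V"
    and "R \<equiv> U * rdiag (map sqrt a) * adj U"
  shows "svals (A * B) = map sqrt (eigs (adj (sandwich W a b) * sandwich W a b))"
    "eigs (R * B * R) =
      eigs (adj (sandwich W (map sqrt a) (map sqrt b)) * sandwich W (map sqrt a) (map sqrt b))"
proof -
  note UU = unitaryD[OF U] note VV = unitaryD[OF V]
  have cW: "W \<in> carrier_mat m m" using UU VV by (simp add: W)
  note dims = carrier_matD[OF UU(1)] carrier_matD[OF VV(1)] len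
  have K: "sandwich W x y \<in> carrier_mat m m" if "length x = m" "length y = m" for x y
    using sandwich_carrier[OF cW that] .
  define K0 where "K0 = sandwich W a b"
  have K0: "K0 \<in> carrier_mat m m" using K[OF len] by (simp add: K0_def)
  have AB: "A * B = U * (K0 * adj V)"
    unfolding A_def B_def K0_def sandwich_def W by (simp add: assoc_mult_mat_dim dims)
  have cKV: "K0 * adj V \<in> carrier_mat m m" using K0 VV by simp
  have "adj (A * B) * (A * B) = adj (K0 * adj V) * (adj U * U) * (K0 * adj V)"
    unfolding AB by (rule adj_mult_self_mult[OF UU(1) cKV])
  also have "\<dots> = adj (K0 * adj V) * (K0 * adj V)"
    unfolding UU(4) right_mult_one_mat[OF adj_carrier[OF cKV]] ..
  also have "\<dots> = V * (adj K0 * K0) * adj V"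
    using adj_mult_self_mult[OF K0 VV(2)] by simp
  finally have "eigs (adj (A * B) * (A * B)) = eigs (adj K0 * K0)"
    using eigs_cong[OF char_poly_unitary_conj[OF V, of "adj K0 * K0"]] K0 by simp
  then show "svals (A * B) = map sqrt (eigs (adj (sandwich W a b) * sandwich W a b))"
    by (simp add: svals_def K0_def)
  have ls: "length (map sqrt a) = m" "length (map sqrt b) = m" using len by auto
  define K1 where "K1 = sandwich W (map sqrt a) (map sqrt b)"
  have K1: "K1 \<in> carrier_mat m m" using K[OF ls] by (simp add: K1_def)
  have bb: "rdiag b = rdiag (map sqrt b) * rdiag (map sqrt b)"
    using nn len by (subst rdiag_mult[OF ls(2) ls(2)]) (auto intro!: arg_cong[of _ _ rdiag] nth_equalityI)
  have "R * B * R = U * (K1 * adj K1) * adj U"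
    unfolding R_def B_def bb K1_def adj_sandwich[OF cW ls]
    unfolding sandwich_def W using UU VV
    by (simp add: assoc_mult_mat_dim dims adj_mult[OF UU(2) VV(1)])
  then have "eigs (R * B * R) = eigs (K1 * adj K1)"
    using eigs_cong[OF char_poly_unitary_conj[OF U, of "K1 * adj K1"]] K1 by simp
  also have "\<dots> = eigs (adj K1 * K1)"
    using K1 by (intro eigs_cong char_poly_mult_comm) auto
  finally show "eigs (R * B * R) =
      eigs (adj (sandwich W (map sqrt a) (map sqrt b)) * sandwich W (map sqrt a) (map sqrt b))"
    by (simp add: K1_def)
qed

theorem theorem2p1:
  fixes m :: nat and A1 A2 B1 B2 :: "complex mat" and \<theta> :: real
    and pw :: "real \<Rightarrow> real \<Rightarrow> real"
  assumes "psd m A1" "psd m A2" "psd m B1" "psd m B2"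
    and "A1 * A2 = A2 * A1" and "B1 * B2 = B2 * B1"
    and "0 \<le> \<theta>" "\<theta> \<le> 1"
    and "pw = pow_conv1 \<or> pw = pow_conv2"
  shows "log_majorized
           (eigs (mpow pw (mpow pw A1 \<theta> * mpow pw A2 (1 - \<theta>)) (1/2)
                  * (mpow pw B1 \<theta> * mpow pw B2 (1 - \<theta>))
                  * mpow pw (mpow pw A1 \<theta> * mpow pw A2 (1 - \<theta>)) (1/2)))
           (map2 (\<lambda>x y. pw x \<theta> * pw y (1 - \<theta>))
              (eigs (mpow pw A1 (1/2) * B1 * mpow pw A1 (1/2)))
              (eigs (mpow pw A2 (1/2) * B2 * mpow pw A2 (1/2))))
       \<and> log_majorized
           (svals ((mpow pw A1 \<theta> * mpow pw A2 (1 - \<theta>)) * (mpow pw B1 \<theta> * mpow pw B2 (1 - \<theta>))))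
           (map2 (\<lambda>x y. pw x \<theta> * pw y (1 - \<theta>)) (svals (A1 * B1)) (svals (A2 * B2)))"
proof -
  note pw = assms(9)
  obtain U a1 a2 where U: "unitary m U" and la: "length a1 = m" "length a2 = m"
    and A: "A1 = U * rdiag a1 * adj U" "A2 = U * rdiag a2 * adj U"
    and na: "\<And>x. x \<in> set a1 \<union> set a2 \<Longrightarrow> 0 \<le> x"
    using commuting_psd_diagonalization[OF assms(1,2,5)] by blast
  obtain V b1 b2 where V: "unitary m V" and lb: "length b1 = m" "length b2 = m"
    and B: "B1 = V * rdiag b1 * adj V" "B2 = V * rdiag b2 * adj V"
    and nb: "\<And>x. x \<in> set b1 \<union> set b2 \<Longrightarrow> 0 \<le> x"
    using commuting_psd_diagonalization[OF assms(3,4,6)] by blast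
  \<comment> \<open>The relative position of the two eigenbases, the same for every
    exponent.\<close>
  define W where "W = adj U * V"
  have W: "unitary m W" unfolding W_def by (rule unitary_mult[OF unitary_adj[OF U] V])
  define a b where "a = map2 (wmean pw \<theta>) a1 a2" and "b = map2 (wmean pw \<theta>) b1 b2"
  have l: "length a = m" "length b = m" using la lb by (auto simp: a_def b_def)
  have n: "0 \<le> x" if "x \<in> set a \<union> set b" for x
    using that by (auto simp: a_def b_def wmean_def pw_nonneg[OF pw])
  \<comment> \<open>The conventions differ at exponent 0 alone, so square roots are
    unambiguous.\<close>
  have pw_half: "pw x (1/2) = sqrt x" if "0 \<le> x" for x
    using that by (simp add: pw_pos[OF pw] powr_half_sqrt)
  have half: "mpow pw (U * rdiag x * adj U) (1/2) = U * rdiag (map sqrt x) * adj U"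
    if "length x = m" "\<And>z. z \<in> set x \<Longrightarrow> 0 \<le> z" for x
  proof -
    have "map (\<lambda>z. pw z (1/2)) x = map sqrt x" using that by (auto simp: pw_half)
    then show ?thesis unfolding mpow_def mfun_unitary_rdiag[OF U that(1)] by (simp only:)
  qed
  have mean: "mpow pw (X * rdiag x * adj X) \<theta> * mpow pw (X * rdiag y * adj X) (1 - \<theta>) =
      X * rdiag (map2 (wmean pw \<theta>) x y) * adj X"
    if "unitary m X" "length x = m" "length y = m" for X x y
  proof -
    have "map2 (*) (map (\<lambda>z. pw z \<theta>) x) (map (\<lambda>z. pw z (1 - \<theta>)) y) = map2 (wmean pw \<theta>) x y"
      using that by (intro nth_equalityI) (auto simp: wmean_def)
    then show ?thesis
      using unitary_rdiag_mult[OF that(1), of "map (\<lambda>z. pw z \<theta>) x" "map (\<lambda>z. pw z (1 - \<theta>)) y"] that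
      by (simp add: mpow_def mfun_unitary_rdiag)
  qed
  have AA: "mpow pw A1 \<theta> * mpow pw A2 (1 - \<theta>) = U * rdiag a * adj U"
    unfolding A a_def by (rule mean[OF U la])
  have BB: "mpow pw B1 \<theta> * mpow pw B2 (1 - \<theta>) = V * rdiag b * adj V"
    unfolding B b_def by (rule mean[OF V lb])
  have sqrt_mean: "map sqrt (map2 (wmean pw \<theta>) x y) = map2 (wmean pw \<theta>) (map sqrt x) (map sqrt y)"
    if "length x = m" "length y = m" "\<And>z. z \<in> set x \<union> set y \<Longrightarrow> 0 \<le> z" for x y
    using that by (intro nth_equalityI) (auto simp: wmean_def pw_sqrt[OF pw] real_sqrt_mult)
  have sa: "map sqrt a = map2 (wmean pw \<theta>) (map sqrt a1) (map sqrt a2)"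
    unfolding a_def using la na by (intro sqrt_mean) auto
  have sb: "map sqrt b = map2 (wmean pw \<theta>) (map sqrt b1) (map sqrt b2)"
    unfolding b_def using lb nb by (intro sqrt_mean) auto
  have mean_eta: "(\<lambda>x y. pw x \<theta> * pw y (1 - \<theta>)) = wmean pw \<theta>"
    by (intro ext) (simp add: wmean_def)
  have n1: "0 \<le> z" if "z \<in> set a1 \<union> set b1" for z using that na nb by blast
  have n2: "0 \<le> z" if "z \<in> set a2 \<union> set b2" for z using that na nb by blast
  have half': "mpow pw (U * rdiag a * adj U) (1/2) = U * rdiag (map sqrt a) * adj U"
    "mpow pw (U * rdiag a1 * adj U) (1/2) = U * rdiag (map sqrt a1) * adj U"
    "mpow pw (U * rdiag a2 * adj U) (1/2) = U * rdiag (map sqrt a2) * adj U"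
    using l la n na by (auto intro!: half)
  note prods = eigs_sandwich_products[OF U V l n W_def]
    eigs_sandwich_products[OF U V la(1) lb(1) n1 W_def] eigs_sandwich_products[OF U V la(2) lb(2) n2 W_def]
  have "\<theta> \<in> {0..1}" using assms(7,8) by simp
  note main = log_majorized_wmean[OF W _ _ _ _ _ this pw]
  show ?thesis
    unfolding AA BB mean_eta
  proof (intro conjI)
    \<comment> \<open>Taking roots commutes with the weighted mean (\<open>sa\<close>,
      \<open>sb\<close>), so the rooted diagonals again form a path of the required shape.\<close>
    have "log_majorized
        (eigs (adj (sandwich W (map sqrt a) (map sqrt b)) * sandwich W (map sqrt a) (map sqrt b)))
        (map2 (wmean pw \<theta>)
          (eigs (adj (sandwich W (map sqrt a1) (map sqrt b1)) * sandwich W (map sqrt a1) (map sqrt b1)))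
          (eigs (adj (sandwich W (map sqrt a2) (map sqrt b2)) * sandwich W (map sqrt a2) (map sqrt b2))))"
      unfolding sa sb using la lb na nb by (intro main(1)) auto
    then show "log_majorized
        (eigs (mpow pw (U * rdiag a * adj U) (1/2) * (V * rdiag b * adj V) * mpow pw (U * rdiag a * adj U) (1/2)))
        (map2 (wmean pw \<theta>) (eigs (mpow pw A1 (1/2) * B1 * mpow pw A1 (1/2)))
          (eigs (mpow pw A2 (1/2) * B2 * mpow pw A2 (1/2))))"
      unfolding A B half' by (simp only: prods)
    have "log_majorized (map sqrt (eigs (adj (sandwich W a b) * sandwich W a b)))
        (map2 (wmean pw \<theta>) (map sqrt (eigs (adj (sandwich W a1 b1) * sandwich W a1 b1)))
          (map sqrt (eigs (adj (sandwich W a2 b2) * sandwich W a2 b2))))"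
      unfolding a_def b_def using la lb na nb by (intro main(2)) auto
    then show "log_majorized (svals (U * rdiag a * adj U * (V * rdiag b * adj V)))
        (map2 (wmean pw \<theta>) (svals (A1 * B1)) (svals (A2 * B2)))"
      unfolding A B by (simp only: prods)
  qed
qed

end
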